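(* The emptiness problem and the containment problem are both undecidable for the class of linearly ambiguous probabilistic automata. That is: (i) there is no algorithm which, given a linearly ambiguous probabilistic automaton $\mathcal{A}$ over an alphabet $\Sigma$, decides whether $[\![\mathcal{A}]\!](w)\le\frac12$ for all $w\in\Sigma^*$; and (ii) there is no algorithm which, given two linearly ambiguous probabilistic automata $\mathcal{A},\mathcal{B}$ over a common alphabet $\Sigma$, decides whether $[\![\mathcal{A}]\!](w)\le[\![\mathcal{B}]\!](w)$ for all $w\in\Sigma^*$.
   Context: A distribution over a finite set $S$ is a function $f:S\to\mathbb{Q}_{\ge 0}$ with $\sum_{s\in S} f(s)\le 1$; $\mathcal{D}(S)$ is the set of distributions over $S$. A probabilistic automaton (PA) is a tuple $\mathcal{A}=(\Sigma,Q,\delta,\iota,F)$ with finite alphabet $\Sigma$, finite state set $Q$, transition function $\delta:Q\times\Sigma\to\mathcal{D}(Q)$ (write $\delta(q,a,p)=\delta(q,a)(p)$), initial distribution $\iota\in\mathcal{D}(Q)$ and final states $F\subseteq Q$. A run over $w=a_1\dots a_n$ is a sequence of transitions $(q_0,a_1,q_1),\dots,(q_{n-1},a_n,q_n)$ with $\delta(q_{i-1},a_i,q_i)>0$ for all $1\le i\le n$; it is accepting if $\iota(q_0)>0$ and $q_n\in F$. Its probability is $\iota(q_0)\prod_{i=1}^n\delta(q_{i-1},a_i,q_i)$. $[\![\mathcal{A}]\!](w)$ is the sum of the probabilities of all accepting runs over $w$. $\mathcal{A}$ is linearly ambiguous if there is a polynomial $P$ of degree at most $1$ such that for every word $w$ the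 number of accepting runs of $\mathcal{A}$ over $w$ is at most $P(|w|)$. *)

theory Defs
  imports
    Complex_Main
    "HOL-Library.Nat_Bijection"
    "HOL-Computational_Algebra.Polynomial"
begin

section \<open>Probabilistic automata\<close>

text \<open>
  Distributions are rational-valued with total mass at most 1; the values of the
  function outside \<open>S\<close> are irrelevant.
\<close>

definition distribution_on :: "'s set \<Rightarrow> ('s \<Rightarrow> rat) \<Rightarrow> bool" where
  "distribution_on S f \<longleftrightarrow> (\<forall>s\<in>S. 0 \<le> f s) \<and> (\<Sum>s\<in>S. f s) \<le> 1"

record ('a, 'q) pa =
  alphabet :: "'a set"
  states :: "'q set"
  delta :: "'q \<Rightarrow> 'a \<Rightarrow> 'q \<Rightarrow> rat"
  init :: "'q \<Rightarrow> rat"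
  final :: "'q set"

definition is_pa :: "('a, 'q) pa \<Rightarrow> bool" where
  "is_pa A \<longleftrightarrow>
     finite (alphabet A) \<and> finite (states A) \<and>
     (\<forall>q\<in>states A. \<forall>a\<in>alphabet A. distribution_on (states A) (delta A q a)) \<and>
     distribution_on (states A) (init A) \<and>
     final A \<subseteq> states A"

text \<open>
  A run over a word of length \<open>n\<close> is given by its sequence \<open>q\<^sub>0, \<dots>, q\<^sub>n\<close> of states. Together
  with the word this determines the transitions, and for the empty word it also records \<open>q\<^sub>0\<close>.
\<close>

definition is_run :: "('a, 'q) pa \<Rightarrow> 'a list \<Rightarrow> 'q list \<Rightarrow> bool" where
  "is_run A w qs \<longleftrightarrow>
     length qs = Suc (length w) \<and> set qs \<subseteq> states A \<and>
     (\<forall>i<length w. delta A (qs ! i) (w ! i) (qs ! Suc i) > 0)"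

definition accepting_runs :: "('a, 'q) pa \<Rightarrow> 'a list \<Rightarrow> 'q list set" where
  "accepting_runs A w = {qs. is_run A w qs \<and> init A (hd qs) > 0 \<and> last qs \<in> final A}"

definition run_prob :: "('a, 'q) pa \<Rightarrow> 'a list \<Rightarrow> 'q list \<Rightarrow> rat" where
  "run_prob A w qs = init A (hd qs) * (\<Prod>i<length w. delta A (qs ! i) (w ! i) (qs ! Suc i))"

definition acc_prob :: "('a, 'q) pa \<Rightarrow> 'a list \<Rightarrow> rat" where
  "acc_prob A w = (\<Sum>qs\<in>accepting_runs A w. run_prob A w qs)"

definition linearly_ambiguous :: "('a, 'q) pa \<Rightarrow> bool" where
  "linearly_ambiguous A \<longleftrightarrow>
     (\<exists>P :: real poly. degree P \<le> 1 \<and>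
        (\<forall>w\<in>lists (alphabet A). real (card (accepting_runs A w)) \<le> poly P (real (length w))))"

text \<open>The sums and cardinalities above range over finite sets.\<close>

lemma finite_accepting_runs:
  assumes "is_pa A"
  shows "finite (accepting_runs A w)"
proof (rule finite_subset)
  show "accepting_runs A w \<subseteq> {qs. set qs \<subseteq> states A \<and> length qs = Suc (length w)}"
    by (auto simp: accepting_runs_def is_run_def)
  show "finite {qs. set qs \<subseteq> states A \<and> length qs = Suc (length w)}"
    using assms by (intro finite_lists_length_eq) (simp add: is_pa_def)
qed


section \<open>Partial recursive functions\<close>

text \<open>
  Algorithms are programs for partial recursive functions: the initial functions closed under
  composition, primitive recursion and unbounded minimisation. The relation
  \<open>computes f xs y\<close> says that \<open>f\<close> halts on the arguments \<open>xs\<close> with result \<open>y\<close>.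
\<close>

datatype recf =
    Zero
  | Succ
  | Proj nat
  | Comp recf "recf list"
  | PrimRec recf recf
  | Mu recf

inductive computes :: "recf \<Rightarrow> nat list \<Rightarrow> nat \<Rightarrow> bool" where
  zero: "computes Zero xs 0"
| succ: "computes Succ [x] (Suc x)"
| proj: "i < length xs \<Longrightarrow> computes (Proj i) xs (xs ! i)"
| comp: "list_all2 (\<lambda>g z. computes g xs z) gs zs \<Longrightarrow> computes f zs y \<Longrightarrow> computes (Comp f gs) xs y"
| primrec_0: "computes f xs y \<Longrightarrow> computes (PrimRec f g) (0 # xs) y"
| primrec_Suc: "computes (PrimRec f g) (n # xs) r \<Longrightarrow> computes g (n # r # xs) y \<Longrightarrow>
    computes (PrimRec f g) (Suc n # xs) y"
| mu: "computes f (n # xs) 0 \<Longrightarrow> (\<forall>m<n. \<exists>z. computes f (m # xs) (Suc z)) \<Longrightarrow>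
    computes (Mu f) xs n"

lemma computes_deterministic:
  assumes "computes f xs y" "computes f xs y'"
  shows "y = y'"
  using assms
proof (induction arbitrary: y' rule: computes.induct)
  case (comp xs gs zs f y)
  from comp.prems obtain zs' where zs': "list_all2 (\<lambda>g z. computes g xs z) gs zs'"
      and f: "computes f zs' y'"
    by (cases rule: computes.cases) auto
  have "zs = zs'"
  proof (rule nth_equalityI)
    show "length zs = length zs'"
      using comp.IH(1) zs' by (auto dest!: list_all2_lengthD)
    fix i assume "i < length zs"
    then show "zs ! i = zs' ! i"
      using comp.IH(1) zs' by (auto simp: list_all2_conv_all_nth)
  qed
  with comp.IH(2) f show ?case by simp
next
  case (primrec_0 f xs y g)
  from primrec_0.prems have "computes f xs y'"
    by (cases rule: computes.cases) auto
  then show ?case by (rule primrec_0.IH)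
next
  case (primrec_Suc f g n xs r y)
  from primrec_Suc.prems obtain r' where "computes (PrimRec f g) (n # xs) r'"
      "computes g (n # r' # xs) y'"
    by (cases rule: computes.cases) auto
  with primrec_Suc.IH show ?case by blast
next
  case (mu f n xs)
  from mu.prems have y': "computes f (y' # xs) 0" "\<forall>m<y'. \<exists>z. computes f (m # xs) (Suc z)"
    by (cases rule: computes.cases; auto)+
  show ?case
  proof (rule linorder_cases[of n y'])
    assume "n < y'"
    then obtain z where "computes f (n # xs) (Suc z)" using y' by blast
    with mu.IH(1) show ?thesis by force
  next
    assume "y' < n"
    with mu.IH(2) obtain z where "\<And>u. computes f (y' # xs) u \<Longrightarrow> Suc z = u" by blast
    with y' show ?thesis by force
  qed simp
qed (auto elim: computes.cases)

text \<open>
  Decidability of a promise problem: the inputs are the tuples in \<open>I\<close>, and a decision procedure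
  has to halt with the right answer on all of them; nothing is required outside \<open>I\<close>.
\<close>

definition decidable_on :: "nat list set \<Rightarrow> nat list set \<Rightarrow> bool" where
  "decidable_on I Y \<longleftrightarrow> (\<exists>f. \<forall>xs\<in>I. computes f xs (if xs \<in> Y then 1 else 0))"


section \<open>Probabilistic automata as inputs\<close>

text \<open>
  A probabilistic automaton with alphabet \<open>{..<k}\<close> and states \<open>{..<n}\<close> is presented by a natural
  number, using the (effective) codings of pairs and lists from \<^theory>\<open>HOL-Library.Nat_Bijection\<close>.
  The finitely many values of the initial distribution and of the transition function are listed in
  tables of key-value pairs; absent keys have the value 0, and the first entry for a key counts.
  The pair \<open>(m, d)\<close> stands for the rational number \<open>m / (d + 1)\<close>.
\<close>

definition rat_of_code :: "nat \<Rightarrow> rat" where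
  "rat_of_code v = (case prod_decode v of (m, d) \<Rightarrow> of_nat m / of_nat (Suc d))"

definition lookup_code :: "nat \<Rightarrow> nat \<Rightarrow> rat" where
  "lookup_code t x =
     (case map_of (map prod_decode (list_decode t)) x of None \<Rightarrow> 0 | Some v \<Rightarrow> rat_of_code v)"

definition pa_of_code :: "nat \<Rightarrow> (nat, nat) pa" where
  "pa_of_code c =
     (let (k, c1) = prod_decode c;
          (n, c2) = prod_decode c1;
          (d, c3) = prod_decode c2;
          (i, f) = prod_decode c3
      in \<lparr>alphabet = {..<k}, states = {..<n},
          delta = (\<lambda>q a p. lookup_code d (prod_encode (q, prod_encode (a, p)))),
          init = lookup_code i,
          final = set (list_decode f)\<rparr>)"

text \<open>Up to renaming of letters and states, every probabilistic automaton has a code.\<close>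

lemma rat_of_code_surj:
  assumes "0 \<le> x"
  obtains v where "rat_of_code v = x"
proof -
  obtain a b where ab: "quotient_of x = (a, b)" by (cases "quotient_of x")
  have b: "b > 0" using quotient_of_denom_pos[OF ab] .
  have x: "x = of_int a / of_int b" using quotient_of_div[OF ab] .
  have "a \<ge> 0" using assms b unfolding x by (simp add: zero_le_divide_iff)
  then have "rat_of_code (prod_encode (nat a, nat (b - 1))) = x"
    using b unfolding x rat_of_code_def by (simp add: of_nat_nat)
  then show thesis by (rule that)
qed

lemma lookup_code_surj:
  assumes "finite X" "\<And>x. x \<in> X \<Longrightarrow> 0 \<le> f x"
  obtains t where "\<And>x. x \<in> X \<Longrightarrow> lookup_code t x = f x"
proof -
  have "\<exists>t. \<forall>x\<in>X. lookup_code t x = f x"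
    using assms
  proof (induction X rule: finite_induct)
    case (insert y X)
    then obtain t where t: "\<forall>x\<in>X. lookup_code t x = f x" by auto
    obtain v where v: "rat_of_code v = f y"
      using insert.prems rat_of_code_surj by (metis insertI1)
    have "\<forall>x\<in>insert y X.
        lookup_code (list_encode (prod_encode (y, v) # list_decode t)) x = f x"
      using t v insert.hyps by (auto simp: lookup_code_def)
    then show ?case by blast
  qed simp
  with that show thesis by blast
qed

lemma pa_has_code:
  fixes A :: "('a, 'q) pa"
  assumes A: "is_pa A" and h: "bij_betw h (alphabet A) {..<k}"
  obtains c g where
    "is_pa (pa_of_code c)"
    "alphabet (pa_of_code c) = {..<k}"
    "bij_betw g (states A) (states (pa_of_code c))"
    "final (pa_of_code c) = g ` final A"
    "\<And>q. q \<in> states A \<Longrightarrow> init (pa_of_code c) (g q) = init A q"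
    "\<And>q a p. q \<in> states A \<Longrightarrow> a \<in> alphabet A \<Longrightarrow> p \<in> states A \<Longrightarrow>
       delta (pa_of_code c) (g q) (h a) (g p) = delta A q a p"
proof -
  have fin: "finite (states A)" and F: "final A \<subseteq> states A"
    and \<iota>: "distribution_on (states A) (init A)"
    and \<delta>: "\<And>q a. q \<in> states A \<Longrightarrow> a \<in> alphabet A \<Longrightarrow> distribution_on (states A) (delta A q a)"
    using A by (auto simp: is_pa_def)
  define n where "n = card (states A)"
  obtain g where g: "bij_betw g (states A) {..<n}"
    using ex_bij_betw_finite_nat[OF fin] by (auto simp: n_def atLeast0LessThan)
  define g' where "g' = inv_into (states A) g"
  define h' where "h' = inv_into (alphabet A) h"
  have g': "g' x \<in> states A" "g (g' x) = x" if "x < n" for x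
    using g that by (auto simp: g'_def bij_betw_def inv_into_into f_inv_into_f)
  have h': "h' x \<in> alphabet A" "h (h' x) = x" if "x < k" for x
    using h that by (auto simp: h'_def bij_betw_def inv_into_into f_inv_into_f)
  have g'g: "g' (g q) = q" "g q < n" if "q \<in> states A" for q
    using g that by (auto simp: g'_def bij_betw_def)
  have h'h: "h' (h a) = a" "h a < k" if "a \<in> alphabet A" for a
    using h that by (auto simp: h'_def bij_betw_def)
  have bij: "bij_betw g' {..<n} (states A)"
    unfolding g'_def by (rule bij_betw_inv_into[OF g])
  obtain i where i: "\<And>x. x \<in> {..<n} \<Longrightarrow> lookup_code i x = init A (g' x)"
    by (rule lookup_code_surj[of "{..<n}" "\<lambda>x. init A (g' x)"])
      (use g' \<iota> in \<open>auto simp: distribution_on_def\<close>)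
  define X where
    "X = (\<lambda>(q, a, p). prod_encode (q, prod_encode (a, p))) ` ({..<n} \<times> {..<k} \<times> {..<n})"
  define T where
    "T x = (case prod_decode x of (q, y) \<Rightarrow> case prod_decode y of (a, p) \<Rightarrow>
       delta A (g' q) (h' a) (g' p))" for x
  have "finite X" by (simp add: X_def)
  moreover have "0 \<le> T x" if "x \<in> X" for x
    using that g' h' \<delta> by (auto simp: X_def T_def distribution_on_def)
  ultimately obtain d where d: "\<And>x. x \<in> X \<Longrightarrow> lookup_code d x = T x"
    by (rule lookup_code_surj[of X T]) blast+
  have d': "lookup_code d (prod_encode (q, prod_encode (a, p))) = delta A (g' q) (h' a) (g' p)"
    if "q < n" "a < k" "p < n" for q a p
  proof -
    have "prod_encode (q, prod_encode (a, p)) \<in> X"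
      unfolding X_def using that by (intro image_eqI[where x = "(q, a, p)"]) auto
    from d[OF this] show ?thesis by (simp add: T_def)
  qed
  obtain fs where fs: "set fs = g ` final A"
    using finite_list[of "g ` final A"] fin F by (meson finite_imageI finite_subset)
  define c where
    "c = prod_encode (k, prod_encode (n, prod_encode (d, prod_encode (i, list_encode fs))))"
  have c: "pa_of_code c = \<lparr>alphabet = {..<k}, states = {..<n},
      delta = (\<lambda>q a p. lookup_code d (prod_encode (q, prod_encode (a, p)))),
      init = lookup_code i, final = g ` final A\<rparr>"
    by (simp add: c_def pa_of_code_def fs)
  have dist: "distribution_on {..<n} e"
    if "distribution_on (states A) e'" "\<And>x. x < n \<Longrightarrow> e x = e' (g' x)" for e e'
  proof -
    have "(\<Sum>x<n. e x) = (\<Sum>x<n. e' (g' x))" by (rule sum.cong) (use that in auto)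
    also have "\<dots> = (\<Sum>q\<in>states A. e' q)" by (rule sum.reindex_bij_betw[OF bij])
    finally show ?thesis using that g' by (auto simp: distribution_on_def)
  qed
  show thesis
  proof (rule that[of c g])
    have "distribution_on {..<n} (lookup_code i)"
      by (rule dist[OF \<iota>]) (use i in auto)
    moreover have "distribution_on {..<n}
        (\<lambda>p. lookup_code d (prod_encode (q, prod_encode (a, p))))" if "q < n" "a < k" for q a
      by (rule dist[OF \<delta>[OF g'(1)[OF that(1)] h'(1)[OF that(2)]]]) (use d' that in auto)
    moreover have "g ` final A \<subseteq> {..<n}" using F g by (auto simp: bij_betw_def)
    ultimately show "is_pa (pa_of_code c)" by (simp add: is_pa_def c)
  qed (use g i g'g h'h d' in \<open>simp_all add: c\<close>)
qed

definition linear_code :: "nat \<Rightarrow> bool" where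
  "linear_code c \<longleftrightarrow> is_pa (pa_of_code c) \<and> linearly_ambiguous (pa_of_code c)"

end

theory Submission
  imports Defs "HOL-Library.Infinite_Set" "HOL-Computational_Algebra.Primes"
begin

text \<open>
  Given a program \<open>f\<close> for a partial recursive function, translate it into a finite graph whose edges
  are labelled with relations \<open>a n + s = b n' + t\<close> on a single number that encodes registers as
  exponents of primes. A word lists the numbers of a computation in unary. An automaton
  with \<open>x = 2\<^bsup>-(a n + s)\<^esup>\<close> and \<open>y = 2\<^bsup>-(b n' + t)\<^esup>\<close> realises the value \<open>1/2 - \<epsilon> (x - y)\<^sup>2\<close> for a step,
  with a number of runs that is linear in the length of the two blocks involved. Summing over all
  steps, and adding a reward that decays faster than any possible mismatch if the control path is
  correct, gives a value above 1/2 exactly for the words that describe accepting computations. The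
  starting number enters only as a rational number in the initial distribution. A decision
  procedure could therefore be applied, inside the program \<open>f\<close>, to the automaton that belongs to
  \<open>f\<close> itself, with the data of this automaton as input, and \<open>f\<close> would halt iff it does not halt.
\<close>

section \<open>Recursive functions\<close>

text \<open>Linear ambiguity shapes the construction. A thread with acceptance probability 1 - x^2
  has about one run for each position at which it may leave for \<open>Sink\<close>, and such
  threads start at every edge letter. Hence each thread may branch only inside the two neighbouring
  blocks that it compares, which suits configurations that are single numbers and steps that are
  equations between neighbours. The square makes a deviation in either direction a loss: in (x -
  y)^2 = x^2 + y^2 - 2xy the squares come from branching threads with complementary probability, and
  the product xy is the weight of one single run through both blocks. The number of steps is
  unbounded while a distribution has mass at most 1, so the steps get geometrically decreasing
  weights and a late mismatch counts very little. The reward must be smaller still, therefore it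
  loses the factor \<open>decay\<close> at every letter. For containment, the second automaton
  shares the transitions and has the constant value 1/2.\<close>

definition rec_fun :: "nat \<Rightarrow> (nat list \<Rightarrow> nat) \<Rightarrow> bool" where
  "rec_fun L F \<longleftrightarrow> (\<exists>f. \<forall>xs. length xs = L \<longrightarrow> computes f xs (F xs))"

lemma rec_fun_comp:
  assumes F: "rec_fun (length Gs) F" and Gs: "\<And>G. G \<in> set Gs \<Longrightarrow> rec_fun L G"
  shows "rec_fun L (\<lambda>xs. F (map (\<lambda>G. G xs) Gs))"
proof -
  obtain f where f: "\<And>xs. length xs = length Gs \<Longrightarrow> computes f xs (F xs)"
    using F by (auto simp: rec_fun_def)
  obtain h where h: "\<And>G xs. G \<in> set Gs \<Longrightarrow> length xs = L \<Longrightarrow> computes (h G) xs (G xs)"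
    using Gs unfolding rec_fun_def by metis
  have "computes (Comp f (map h Gs)) xs (F (map (\<lambda>G. G xs) Gs))" if "length xs = L" for xs
  proof (rule comp)
    show "list_all2 (\<lambda>g z. computes g xs z) (map h Gs) (map (\<lambda>G. G xs) Gs)"
      using h that by (auto simp: list_all2_conv_all_nth)
  qed (simp add: f)
  then show ?thesis unfolding rec_fun_def by blast
qed

lemma rec_fun_comp1:
  assumes "rec_fun 1 (\<lambda>xs. h (xs ! 0))" "rec_fun L F"
  shows "rec_fun L (\<lambda>xs. h (F xs))"
  using rec_fun_comp[of "[F]" "\<lambda>xs. h (xs ! 0)" L] assms by simp

lemma rec_fun_comp2:
  assumes "rec_fun 2 (\<lambda>xs. h (xs ! 0) (xs ! 1))" "rec_fun L F" "rec_fun L G"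
  shows "rec_fun L (\<lambda>xs. h (F xs) (G xs))"
  using rec_fun_comp[of "[F, G]" "\<lambda>xs. h (xs ! 0) (xs ! 1)" L] assms
  by (auto simp: numeral_2_eq_2)

lemma rec_fun_nth: "i < L \<Longrightarrow> rec_fun L (\<lambda>xs. xs ! i)"
  unfolding rec_fun_def using proj by blast

lemma rec_fun_Suc: "rec_fun L F \<Longrightarrow> rec_fun L (\<lambda>xs. Suc (F xs))"
proof (erule rec_fun_comp1[where h = Suc, rotated])
  have "computes Succ xs (Suc (xs ! 0))" if "length xs = 1" for xs
    using that succ by (auto simp: length_Suc_conv)
  then show "rec_fun 1 (\<lambda>xs. Suc (xs ! 0))" unfolding rec_fun_def by blast
qed

lemma rec_fun_const: "rec_fun L (\<lambda>_. c)"
proof (induction c)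
  case 0
  then show ?case unfolding rec_fun_def using zero by blast
qed (rule rec_fun_Suc)

lemma rec_fun_primrec:
  assumes "rec_fun L F" "rec_fun (Suc (Suc L)) G"
    and 0: "\<And>xs. length xs = L \<Longrightarrow> H (0 # xs) = F xs"
    and Suc: "\<And>n xs. length xs = L \<Longrightarrow> H (Suc n # xs) = G (n # H (n # xs) # xs)"
  shows "rec_fun (Suc L) H"
proof -
  obtain f g where f: "\<And>xs. length xs = L \<Longrightarrow> computes f xs (F xs)"
    and g: "\<And>xs. length xs = Suc (Suc L) \<Longrightarrow> computes g xs (G xs)"
    using assms(1,2) by (auto simp: rec_fun_def)
  have "computes (PrimRec f g) (n # xs) (H (n # xs))" if "length xs = L" for n xs
  proof (induction n)
    case 0
    then show ?case using f assms(3) that by (auto intro: primrec_0)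
  next
    case (Suc n)
    then show ?case using g assms(4) that by (auto intro!: primrec_Suc)
  qed
  then have "computes (PrimRec f g) xs (H xs)" if "length xs = Suc L" for xs
    using that by (cases xs) auto
  then show ?thesis unfolding rec_fun_def by blast
qed

lemma rec_fun_add: "rec_fun L F \<Longrightarrow> rec_fun L G \<Longrightarrow> rec_fun L (\<lambda>xs. F xs + G xs)"
proof (erule (1) rec_fun_comp2[where h = "(+)", rotated])
  have "rec_fun (Suc 1) (\<lambda>xs. xs ! 0 + xs ! 1)"
    by (rule rec_fun_primrec[where F = "\<lambda>xs. xs ! 0" and G = "\<lambda>xs. Suc (xs ! 1)"])
      (auto intro!: rec_fun_nth rec_fun_Suc)
  then show "rec_fun 2 (\<lambda>xs. xs ! 0 + xs ! 1)" by (simp add: numeral_2_eq_2)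
qed

lemma rec_fun_mult: "rec_fun L F \<Longrightarrow> rec_fun L G \<Longrightarrow> rec_fun L (\<lambda>xs. F xs * G xs)"
proof (erule (1) rec_fun_comp2[where h = "(*)", rotated])
  have "rec_fun (Suc 1) (\<lambda>xs. xs ! 0 * xs ! 1)"
    by (rule rec_fun_primrec[where F = "\<lambda>xs. 0" and G = "\<lambda>xs. xs ! 2 + xs ! 1"])
      (auto intro!: rec_fun_nth rec_fun_add rec_fun_const)
  then show "rec_fun 2 (\<lambda>xs. xs ! 0 * xs ! 1)" by (simp add: numeral_2_eq_2)
qed

lemma rec_fun_power: "rec_fun L F \<Longrightarrow> rec_fun L (\<lambda>xs. c ^ F xs)"
proof (erule rec_fun_comp1[where h = "\<lambda>n. c ^ n", rotated])
  have "rec_fun (Suc 0) (\<lambda>xs. c ^ (xs ! 0))"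
    by (rule rec_fun_primrec[where F = "\<lambda>xs. 1" and G = "\<lambda>xs. c * xs ! 1"])
      (auto intro!: rec_fun_nth rec_fun_mult rec_fun_const)
  then show "rec_fun 1 (\<lambda>xs. c ^ (xs ! 0))" by simp
qed

lemma rec_fun_pred: "rec_fun L F \<Longrightarrow> rec_fun L (\<lambda>xs. F xs - 1)"
proof (erule rec_fun_comp1[where h = "\<lambda>n. n - 1", rotated])
  have "rec_fun (Suc 0) (\<lambda>xs. xs ! 0 - 1)"
    by (rule rec_fun_primrec[where F = "\<lambda>xs. 0" and G = "\<lambda>xs. xs ! 0"])
      (auto intro!: rec_fun_nth rec_fun_const)
  then show "rec_fun 1 (\<lambda>xs. xs ! 0 - 1)" by simp
qed

text \<open>Exchanges the answers 0 and 1 of a decision procedure before they are passed to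
  \<open>Mu\<close>.\<close>

lemma rec_fun_one_minus: "rec_fun L F \<Longrightarrow> rec_fun L (\<lambda>xs. 1 - F xs)"
proof (erule rec_fun_comp1[where h = "\<lambda>n. 1 - n", rotated])
  have "rec_fun (Suc 0) (\<lambda>xs. 1 - xs ! 0)"
    by (rule rec_fun_primrec[where F = "\<lambda>xs. 1" and G = "\<lambda>xs. 0"])
      (auto intro!: rec_fun_const)
  then show "rec_fun 1 (\<lambda>xs. 1 - xs ! 0)" by simp
qed

lemma rec_fun_prod_encode:
  assumes "rec_fun L F" "rec_fun L G"
  shows "rec_fun L (\<lambda>xs. prod_encode (F xs, G xs))"
proof -
  have "rec_fun (Suc 0) (\<lambda>xs. triangle (xs ! 0))"
    by (rule rec_fun_primrec[where F = "\<lambda>xs. 0" and G = "\<lambda>xs. Suc (xs ! 0) + xs ! 1"])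
      (auto intro!: rec_fun_const rec_fun_nth rec_fun_add rec_fun_Suc simp del: add_Suc)
  then have "rec_fun 1 (\<lambda>xs. triangle (xs ! 0))" by simp
  then show ?thesis
    using assms unfolding prod_encode_def
    by (auto intro!: rec_fun_add intro: rec_fun_comp1[where h = triangle])
qed

lemmas rec_fun_intros =
  rec_fun_const rec_fun_nth rec_fun_Suc rec_fun_add rec_fun_mult rec_fun_power rec_fun_pred
  rec_fun_prod_encode

section \<open>Register programs\<close>

text \<open>Regular programs with relational semantics: a partial relation acts as a test, and a
  failed test leaves no result. The atoms are a parameter because the same syntax serves registers
  and affine relations.\<close>

datatype 'a prog = Atom 'a | Alt "'a prog" "'a prog" | Seq "'a prog" "'a prog" | Star "'a prog"

primrec sem :: "('a \<Rightarrow> 's rel) \<Rightarrow> 'a prog \<Rightarrow> 's rel" where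
  "sem A (Atom a) = A a"
| "sem A (Alt P Q) = sem A P \<union> sem A Q"
| "sem A (Seq P Q) = sem A P O sem A Q"
| "sem A (Star P) = (sem A P)\<^sup>*"

datatype reg_op = Inc nat | Dec nat | IsZero nat

fun reg_step :: "reg_op \<Rightarrow> (nat \<Rightarrow> nat) rel" where
  "reg_step (Inc r) = {(\<sigma>, \<tau>). \<tau> = \<sigma>(r := Suc (\<sigma> r))}"
| "reg_step (Dec r) = {(\<sigma>, \<tau>). \<sigma> r > 0 \<and> \<tau> = \<sigma>(r := \<sigma> r - 1)}"
| "reg_step (IsZero r) = {(\<sigma>, \<tau>). \<sigma> r = 0 \<and> \<tau> = \<sigma>}"

abbreviation "rsem \<equiv> sem reg_step"

section \<open>Loops and transfer between registers\<close>

definition loop :: "nat \<Rightarrow> reg_op prog \<Rightarrow> reg_op prog" where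
  "loop r P = Seq (Star (Seq (Atom (Dec r)) P)) (Atom (IsZero r))"

text \<open>The star guesses the number of rounds; \<open>Dec r\<close> blocks a round at 0 and
  \<open>IsZero r\<close> blocks an early exit, so what remains is a while loop.\<close>

lemma rsem_loop:
  "(\<sigma>, \<tau>) \<in> rsem (loop r P) \<longleftrightarrow>
     (if \<sigma> r = 0 then \<tau> = \<sigma>
      else \<exists>\<rho>. (\<sigma>(r := \<sigma> r - 1), \<rho>) \<in> rsem P \<and> (\<rho>, \<tau>) \<in> rsem (loop r P))"
proof -
  define S where "S = rsem (Seq (Atom (Dec r)) P)"
  have S: "(\<sigma>, \<rho>) \<in> S \<longleftrightarrow> \<sigma> r > 0 \<and> (\<sigma>(r := \<sigma> r - 1), \<rho>) \<in> rsem P" for \<sigma> \<rho>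
    by (auto simp: S_def relcomp_unfold)
  have L: "(\<sigma>, \<tau>) \<in> rsem (loop r P) \<longleftrightarrow> (\<sigma>, \<tau>) \<in> S\<^sup>* \<and> \<tau> r = 0" for \<sigma> \<tau>
    by (auto simp: S_def loop_def simp del: sem.simps(3) simp: sem.simps(3)[of _ "Star _"])
  have "(\<sigma>, \<tau>) \<in> S\<^sup>* \<longleftrightarrow> \<sigma> = \<tau> \<or> (\<exists>\<rho>. (\<sigma>, \<rho>) \<in> S \<and> (\<rho>, \<tau>) \<in> S\<^sup>*)"
    by (metis converse_rtranclE converse_rtrancl_into_rtrancl rtrancl.rtrancl_refl)
  then show ?thesis unfolding L S by auto
qed

text \<open>The body asks for a successor to be 0, so it is the empty relation, and the star of the
  empty relation is the identity.\<close>

definition skip :: "reg_op prog" where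
  "skip = Star (Seq (Atom (Inc 0)) (Atom (IsZero 0)))"

lemma rsem_skip: "(\<sigma>, \<tau>) \<in> rsem skip \<longleftrightarrow> \<tau> = \<sigma>"
proof -
  have "rsem (Seq (Atom (Inc 0)) (Atom (IsZero 0))) = {}" by auto
  then show ?thesis unfolding skip_def by auto
qed

definition clear :: "nat \<Rightarrow> reg_op prog" where
  "clear r = loop r skip"

lemma rsem_clear: "(\<sigma>, \<tau>) \<in> rsem (clear r) \<longleftrightarrow> \<tau> = \<sigma>(r := 0)"
proof (induction "\<sigma> r" arbitrary: \<sigma>)
  case 0
  then show ?case unfolding clear_def by (subst rsem_loop) auto
next
  case (Suc n)
  show ?case unfolding clear_def
    using Suc(1)[of "\<sigma>(r := n)"] Suc(2)[symmetric]
    by (subst rsem_loop) (auto simp: rsem_skip clear_def)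
qed

definition move2 :: "nat \<Rightarrow> nat \<Rightarrow> nat \<Rightarrow> reg_op prog" where
  "move2 r x y = loop r (Seq (Atom (Inc x)) (Atom (Inc y)))"

lemma rsem_move2:
  assumes "r \<noteq> x" "r \<noteq> y" "x \<noteq> y"
  shows "(\<sigma>, \<tau>) \<in> rsem (move2 r x y) \<longleftrightarrow> \<tau> = \<sigma>(r := 0, x := \<sigma> x + \<sigma> r, y := \<sigma> y + \<sigma> r)"
proof (induction "\<sigma> r" arbitrary: \<sigma>)
  case 0
  then show ?case unfolding move2_def by (subst rsem_loop) auto
next
  case (Suc n)
  show ?case unfolding move2_def
    using Suc(1)[of "\<sigma>(r := n, x := Suc (\<sigma> x), y := Suc (\<sigma> y))"] Suc(2)[symmetric] assms
    by (subst rsem_loop) (auto simp: move2_def relcomp_unfold fun_upd_twist)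
qed

definition move :: "nat \<Rightarrow> nat \<Rightarrow> reg_op prog" where
  "move r x = loop r (Atom (Inc x))"

lemma rsem_move:
  assumes "r \<noteq> x"
  shows "(\<sigma>, \<tau>) \<in> rsem (move r x) \<longleftrightarrow> \<tau> = \<sigma>(r := 0, x := \<sigma> x + \<sigma> r)"
proof (induction "\<sigma> r" arbitrary: \<sigma>)
  case 0
  then show ?case unfolding move_def by (subst rsem_loop) auto
next
  case (Suc n)
  show ?case unfolding move_def
    using Suc(1)[of "\<sigma>(r := n, x := Suc (\<sigma> x))"] Suc(2)[symmetric] assms
    by (subst rsem_loop) (auto simp: move_def fun_upd_twist)
qed

text \<open>A loop reads a register by emptying it. The value is therefore sent to \<open>x\<close>
  and to the scratch register \<open>t\<close>, and moved back from \<open>t\<close>.\<close>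

definition copy :: "nat \<Rightarrow> nat \<Rightarrow> nat \<Rightarrow> reg_op prog" where
  "copy r x t = Seq (move2 r x t) (move t r)"

lemma rsem_copy:
  assumes "r \<noteq> x" "r \<noteq> t" "x \<noteq> t" "\<sigma> t = 0"
  shows "(\<sigma>, \<tau>) \<in> rsem (copy r x t) \<longleftrightarrow> \<tau> = \<sigma>(x := \<sigma> x + \<sigma> r)"
proof -
  define \<rho> where "\<rho> = \<sigma>(r := 0, x := \<sigma> x + \<sigma> r, t := \<sigma> t + \<sigma> r)"
  have "(\<sigma>, \<tau>) \<in> rsem (copy r x t) \<longleftrightarrow> \<tau> = \<rho>(t := 0, r := \<rho> r + \<rho> t)"
    using assms by (simp add: copy_def rsem_move2 rsem_move relcomp_unfold \<rho>_def)
  moreover have "\<rho>(t := 0, r := \<rho> r + \<rho> t) = \<sigma>(x := \<sigma> x + \<sigma> r)"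
    using assms by (auto simp: \<rho>_def fun_eq_iff)
  ultimately show ?thesis by simp
qed

text \<open>
  Registers from \<open>m\<close> on are scratch space. Since the final state is determined exactly, a realizing
  program also leaves its scratch registers at 0, and it has no result at all when \<open>f\<close> diverges.
\<close>

definition realizes ::
  "reg_op prog \<Rightarrow> recf \<Rightarrow> nat list \<Rightarrow> nat \<Rightarrow> nat \<Rightarrow> bool" where
  "realizes P f ins out m \<longleftrightarrow>
     (\<forall>\<sigma> \<tau>. (\<forall>r\<ge>m. \<sigma> r = 0) \<longrightarrow> \<sigma> out = 0 \<longrightarrow>
       ((\<sigma>, \<tau>) \<in> rsem P \<longleftrightarrow> (\<exists>y. computes f (map \<sigma> ins) y \<and> \<tau> = \<sigma>(out := y))))"

lemma computes_Zero_iff: "computes Zero xs y \<longleftrightarrow> y = 0"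
  by (auto intro: computes.intros elim: computes.cases)

lemma computes_Succ_iff: "computes Succ xs y \<longleftrightarrow> (\<exists>x. xs = [x] \<and> y = Suc x)"
  by (auto intro: computes.intros elim: computes.cases)

lemma computes_Proj_iff: "computes (Proj i) xs y \<longleftrightarrow> i < length xs \<and> y = xs ! i"
  by (auto intro: computes.intros elim: computes.cases)

lemma computes_Comp_iff:
  "computes (Comp f gs) xs y \<longleftrightarrow>
     (\<exists>zs. list_all2 (\<lambda>g z. computes g xs z) gs zs \<and> computes f zs y)"
  by (auto intro: computes.intros elim: computes.cases)

lemma computes_PrimRec_Nil: "\<not> computes (PrimRec f g) [] y"
  by (auto elim: computes.cases)

lemma computes_PrimRec_0_iff: "computes (PrimRec f g) (0 # xs) y \<longleftrightarrow> computes f xs y"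
  by (auto intro: computes.intros elim: computes.cases)

lemma computes_PrimRec_Suc_iff:
  "computes (PrimRec f g) (Suc n # xs) y \<longleftrightarrow>
     (\<exists>r. computes (PrimRec f g) (n # xs) r \<and> computes g (n # r # xs) y)"
  by (auto intro: computes.intros elim: computes.cases)

lemma computes_Mu_iff:
  "computes (Mu f) xs n \<longleftrightarrow>
     computes f (n # xs) 0 \<and> (\<forall>m<n. \<exists>z. computes f (m # xs) (Suc z))"
proof
  assume "computes (Mu f) xs n"
  then show "computes f (n # xs) 0 \<and> (\<forall>m<n. \<exists>z. computes f (m # xs) (Suc z))"
    by (cases rule: computes.cases) auto
qed (auto intro: computes.mu)

text \<open>
  Primitive recursion from the point of view of a loop that runs upwards: \<open>k\<close> is the loop counter,
  \<open>a\<close> the accumulator and \<open>j\<close> the number of remaining rounds.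
\<close>

fun iterates :: "recf \<Rightarrow> nat list \<Rightarrow> nat \<Rightarrow> nat \<Rightarrow> nat \<Rightarrow> nat \<Rightarrow> bool" where
  "iterates g xs k a 0 y \<longleftrightarrow> y = a"
| "iterates g xs k a (Suc j) y \<longleftrightarrow>
     (\<exists>b. computes g (k # a # xs) b \<and> iterates g xs (Suc k) b j y)"

text \<open>\<open>PrimRec\<close> unfolds at the last round, the loop at the first one; this
  exchanges the two views.\<close>

lemma iterates_Suc_last:
  "iterates g xs k a (Suc j) y \<longleftrightarrow>
     (\<exists>r. iterates g xs k a j r \<and> computes g ((k + j) # r # xs) y)"
proof (induction j arbitrary: k a)
  case (Suc j)
  show ?case
    by (subst iterates.simps(2), subst Suc.IH) auto
qed auto

lemma computes_PrimRec_iff: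
  "computes (PrimRec f g) (n # xs) y \<longleftrightarrow>
     (\<exists>a. computes f xs a \<and> iterates g xs 0 a n y)"
proof (induction n arbitrary: y)
  case (Suc n)
  show ?case
    unfolding computes_PrimRec_Suc_iff Suc.IH iterates_Suc_last by auto
qed (simp add: computes_PrimRec_0_iff)

section \<open>Compilation of recursive functions into register programs\<close>

definition reg_upd :: "(nat \<Rightarrow> nat) \<Rightarrow> nat \<Rightarrow> nat list \<Rightarrow> nat \<Rightarrow> nat" where
  "reg_upd \<sigma> k zs r = (if k \<le> r \<and> r < k + length zs then zs ! (r - k) else \<sigma> r)"

lemma reg_upd_Nil: "reg_upd \<sigma> k [] = \<sigma>"
  by (auto simp: reg_upd_def fun_eq_iff)

lemma reg_upd_snoc: "reg_upd \<sigma> k (zs @ [z]) = (reg_upd \<sigma> k zs)(k + length zs := z)"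
  by (auto simp: reg_upd_def fun_eq_iff nth_append)

lemma map_reg_upd_below: "set ins \<subseteq> {..<k} \<Longrightarrow> map (reg_upd \<sigma> k zs) ins = map \<sigma> ins"
  by (auto simp: reg_upd_def)

lemma map_reg_upd_block: "length zs = n \<Longrightarrow> map (reg_upd \<sigma> k zs) [k..<k + n] = zs"
  by (auto simp: reg_upd_def intro!: nth_equalityI)

definition realizes_args :: "reg_op prog \<Rightarrow> recf list \<Rightarrow> nat list \<Rightarrow> nat \<Rightarrow> bool" where
  "realizes_args P gs ins k \<longleftrightarrow>
     (\<forall>\<sigma> \<tau>. (\<forall>r\<ge>k. \<sigma> r = 0) \<longrightarrow>
       ((\<sigma>, \<tau>) \<in> rsem P \<longleftrightarrow>
          (\<exists>zs. list_all2 (\<lambda>g z. computes g (map \<sigma> ins) z) gs zs \<and> \<tau> = reg_upd \<sigma> k zs)))"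

text \<open>Induction from the right: the result of the last function goes to the register behind
  all earlier results, and its scratch space starts one register later. The inputs lie below
  \<open>k\<close> and are never overwritten.\<close>

lemma realizable_args:
  assumes "\<And>g m out. g \<in> set gs \<Longrightarrow> set ins \<subseteq> {..<m} \<Longrightarrow> out < m \<Longrightarrow> out \<notin> set ins \<Longrightarrow>
      \<exists>P. realizes P g ins out m"
    and ins: "set ins \<subseteq> {..<k}"
  shows "\<exists>P. realizes_args P gs ins k"
  using assms(1)
proof (induction gs rule: rev_induct)
  case Nil
  show ?case
    by (intro exI[of _ skip]) (simp add: realizes_args_def rsem_skip reg_upd_Nil)
next
  case (snoc g gs)
  then obtain P where P: "realizes_args P gs ins k" by auto
  define out where "out = k + length gs"
  have "set ins \<subseteq> {..<Suc out}" "out \<notin> set ins" using ins by (auto simp: out_def)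
  then obtain G where G: "realizes G g ins out (Suc out)"
    using snoc.prems[of g "Suc out" out] by auto
  have "(\<sigma>, \<tau>) \<in> rsem (Seq P G) \<longleftrightarrow>
        (\<exists>zs. list_all2 (\<lambda>g z. computes g (map \<sigma> ins) z) (gs @ [g]) zs \<and> \<tau> = reg_upd \<sigma> k zs)"
    if \<sigma>: "\<forall>r\<ge>k. \<sigma> r = 0" for \<sigma> \<tau>
  proof -
    have G': "(reg_upd \<sigma> k zs, \<tau>) \<in> rsem G \<longleftrightarrow>
        (\<exists>y. computes g (map \<sigma> ins) y \<and> \<tau> = reg_upd \<sigma> k (zs @ [y]))"
      if "length zs = length gs" for zs
    proof -
      have "\<forall>r\<ge>Suc out. reg_upd \<sigma> k zs r = 0" "reg_upd \<sigma> k zs out = 0"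
        using \<sigma> that by (auto simp: reg_upd_def out_def)
      then show ?thesis
        using G that unfolding realizes_def map_reg_upd_below[OF ins] reg_upd_snoc
        by (simp add: out_def map_reg_upd_below[OF ins])
    qed
    have "(\<sigma>, \<tau>) \<in> rsem (Seq P G) \<longleftrightarrow>
        (\<exists>zs. list_all2 (\<lambda>g z. computes g (map \<sigma> ins) z) gs zs \<and>
           (reg_upd \<sigma> k zs, \<tau>) \<in> rsem G)"
      using P \<sigma> by (auto simp: relcomp_unfold realizes_args_def)
    also have "\<dots> \<longleftrightarrow> (\<exists>zs y. list_all2 (\<lambda>g z. computes g (map \<sigma> ins) z) gs zs \<and>
        computes g (map \<sigma> ins) y \<and> \<tau> = reg_upd \<sigma> k (zs @ [y]))"
      using G' list_all2_lengthD by metis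
    also have "\<dots> \<longleftrightarrow>
        (\<exists>zs. list_all2 (\<lambda>g z. computes g (map \<sigma> ins) z) (gs @ [g]) zs \<and> \<tau> = reg_upd \<sigma> k zs)"
    proof -
      have "list_all2 R (gs @ [g]) zs \<longleftrightarrow> (\<exists>zs' y. zs = zs' @ [y] \<and> list_all2 R gs zs' \<and> R g y)"
        for R :: "recf \<Rightarrow> nat \<Rightarrow> bool" and zs
      proof (cases zs rule: rev_cases)
        case (snoc zs' y)
        then show ?thesis
          by (cases "length gs = length zs'") (auto simp: list_all2_append dest: list_all2_lengthD)
      qed (auto dest: list_all2_lengthD)
      then show ?thesis by auto
    qed
    finally show ?thesis .
  qed
  then have "realizes_args (Seq P G) (gs @ [g]) ins k" unfolding realizes_args_def by blast
  then show ?case by blast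
qed

primrec clear_block :: "nat \<Rightarrow> nat \<Rightarrow> reg_op prog" where
  "clear_block k 0 = skip"
| "clear_block k (Suc n) = Seq (clear_block k n) (clear (k + n))"

lemma rsem_clear_block:
  "(\<sigma>, \<tau>) \<in> rsem (clear_block k n) \<longleftrightarrow> \<tau> = reg_upd \<sigma> k (replicate n 0)"
proof (induction n arbitrary: \<tau>)
  case (Suc n)
  have "replicate (Suc n) (0::nat) = replicate n 0 @ [0]" by (simp add: replicate_append_same)
  then show ?case
    using Suc by (auto simp: rsem_clear relcomp_unfold reg_upd_snoc simp del: replicate_Suc)
qed (simp add: rsem_skip reg_upd_Nil)

lemma realizable_Zero: "realizes skip Zero ins out m"
  by (auto simp: realizes_def rsem_skip computes_Zero_iff fun_upd_idem)

text \<open>The empty relation, used for argument lists whose length admits no value.\<close>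

definition diverge :: "reg_op prog" where
  "diverge = Seq (Atom (Inc 0)) (Atom (IsZero 0))"

lemma rsem_diverge: "(\<sigma>, \<tau>) \<notin> rsem diverge"
  by (auto simp: diverge_def)

lemma realizable_Succ:
  assumes "set ins \<subseteq> {..<m}" "out < m" "out \<notin> set ins"
  shows "\<exists>P. realizes P Succ ins out m"
proof (cases "\<exists>x. ins = [x]")
  case True
  then obtain x where x: "ins = [x]" by auto
  have "realizes (Seq (copy x out m) (Atom (Inc out))) Succ ins out m"
    using assms unfolding realizes_def x
    by (auto simp: relcomp_unfold rsem_copy computes_Succ_iff)
  then show ?thesis by blast
next
  case False
  have "\<not> computes Succ (map \<sigma> ins) y" for \<sigma> y
    using False by (cases ins) (auto simp: computes_Succ_iff)
  then have "realizes diverge Succ ins out m" by (simp add: realizes_def rsem_diverge)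
  then show ?thesis by blast
qed

lemma realizable_Proj:
  assumes "set ins \<subseteq> {..<m}" "out < m" "out \<notin> set ins"
  shows "\<exists>P. realizes P (Proj i) ins out m"
proof (cases "i < length ins")
  case True
  then have "ins ! i \<in> set ins" by simp
  then have "ins ! i < m" "ins ! i \<noteq> out" using assms by auto
  then have "realizes (copy (ins ! i) out m) (Proj i) ins out m"
    using assms True unfolding realizes_def by (auto simp: rsem_copy computes_Proj_iff)
  then show ?thesis by blast
next
  case False
  then have "realizes diverge (Proj i) ins out m"
    by (simp add: realizes_def rsem_diverge computes_Proj_iff)
  then show ?thesis by blast
qed

text \<open>The intermediate results fill the block from \<open>m\<close> to
  \<open>m + n - 1\<close>. It is cleared at the end because the final state may differ from the
  initial one only at \<open>out\<close>.\<close>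

lemma realizable_Comp:
  assumes f: "\<And>ins out m. set ins \<subseteq> {..<m} \<Longrightarrow> out < m \<Longrightarrow> out \<notin> set ins \<Longrightarrow>
      \<exists>P. realizes P f ins out m"
    and gs: "\<And>g ins out m. g \<in> set gs \<Longrightarrow> set ins \<subseteq> {..<m} \<Longrightarrow> out < m \<Longrightarrow> out \<notin> set ins \<Longrightarrow>
      \<exists>P. realizes P g ins out m"
    and ins: "set ins \<subseteq> {..<m}" "out < m" "out \<notin> set ins"
  shows "\<exists>P. realizes P (Comp f gs) ins out m"
proof -
  define n where "n = length gs"
  obtain P where P: "realizes_args P gs ins m"
    using realizable_args[of gs ins m] gs ins(1) by blast
  obtain F where F: "realizes F f [m..<m + n] out (m + n)"
    using f[of "[m..<m + n]" "m + n" out] ins(2) by fastforce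
  have "(\<sigma>, \<tau>) \<in> rsem (Seq P (Seq F (clear_block m n))) \<longleftrightarrow>
      (\<exists>y. computes (Comp f gs) (map \<sigma> ins) y \<and> \<tau> = \<sigma>(out := y))"
    if \<sigma>: "\<forall>r\<ge>m. \<sigma> r = 0" "\<sigma> out = 0" for \<sigma> \<tau>
  proof -
    have F': "(reg_upd \<sigma> m zs, \<tau>) \<in> rsem (Seq F (clear_block m n)) \<longleftrightarrow>
        (\<exists>y. computes f zs y \<and> \<tau> = \<sigma>(out := y))" if "length zs = n" for zs
    proof -
      have "\<forall>r\<ge>m + n. reg_upd \<sigma> m zs r = 0" "reg_upd \<sigma> m zs out = 0"
        using \<sigma> ins(2) that by (auto simp: reg_upd_def)
      then have "(reg_upd \<sigma> m zs, \<rho>) \<in> rsem F \<longleftrightarrow>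
          (\<exists>y. computes f zs y \<and> \<rho> = (reg_upd \<sigma> m zs)(out := y))" for \<rho>
        using F by (simp add: realizes_def map_reg_upd_block[OF that])
      moreover have "reg_upd ((reg_upd \<sigma> m zs)(out := y)) m (replicate n 0) = \<sigma>(out := y)" for y
        using \<sigma> ins(2) that by (auto simp: reg_upd_def fun_eq_iff)
      ultimately show ?thesis by (auto simp: relcomp_unfold rsem_clear_block)
    qed
    have "(\<sigma>, \<tau>) \<in> rsem (Seq P (Seq F (clear_block m n))) \<longleftrightarrow>
        (\<exists>zs. list_all2 (\<lambda>g z. computes g (map \<sigma> ins) z) gs zs \<and>
          (reg_upd \<sigma> m zs, \<tau>) \<in> rsem (Seq F (clear_block m n)))"
      using P \<sigma> by (auto simp: relcomp_unfold realizes_args_def)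
    also have "\<dots> \<longleftrightarrow> (\<exists>zs. list_all2 (\<lambda>g z. computes g (map \<sigma> ins) z) gs zs \<and>
        (\<exists>y. computes f zs y \<and> \<tau> = \<sigma>(out := y)))"
      using F' list_all2_lengthD unfolding n_def by metis
    also have "\<dots> \<longleftrightarrow> (\<exists>y. computes (Comp f gs) (map \<sigma> ins) y \<and> \<tau> = \<sigma>(out := y))"
      by (auto simp: computes_Comp_iff)
    finally show ?thesis .
  qed
  then show ?thesis unfolding realizes_def by blast
qed

lemma realizable_PrimRec:
  assumes f: "\<And>ins out m. set ins \<subseteq> {..<m} \<Longrightarrow> out < m \<Longrightarrow> out \<notin> set ins \<Longrightarrow>
      \<exists>P. realizes P f ins out m"
    and g: "\<And>ins out m. set ins \<subseteq> {..<m} \<Longrightarrow> out < m \<Longrightarrow> out \<notin> set ins \<Longrightarrow>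
      \<exists>P. realizes P g ins out m"
    and ins: "set ins \<subseteq> {..<m}" "out < m" "out \<notin> set ins"
  shows "\<exists>P. realizes P (PrimRec f g) ins out m"
proof (cases ins)
  case Nil
  then have "realizes diverge (PrimRec f g) ins out m"
    by (simp add: realizes_def rsem_diverge computes_PrimRec_Nil)
  then show ?thesis by blast
next
  case (Cons x xs)
  \<comment> \<open>\<open>c\<close> counts the remaining rounds down, \<open>i\<close> is the index
    passed to \<open>g\<close>, \<open>out\<close> holds the accumulator, and \<open>t\<close>
    receives the value of \<open>g\<close> before it replaces \<open>out\<close>.\<close>
  define c i t M where "c = m" and "i = Suc m" and "t = m + 2" and "M = m + 3"
  have regs: "x \<noteq> out" "out < c" "x < c" "c < i" "i < t" "t < M" "c = m"
    using ins Cons by (auto simp: c_def i_def t_def M_def)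
  have xs: "set xs \<subseteq> {..<c}" "out \<notin> set xs" using ins Cons by (auto simp: c_def)
  have "set xs \<subseteq> {..<M}" "set (i # out # xs) \<subseteq> {..<M}" "t \<notin> set (i # out # xs)"
    using xs regs by auto
  then obtain F G where F: "realizes F f xs out M" and G: "realizes G g (i # out # xs) t M"
    using f[of xs M out] g[of "i # out # xs" M t] xs regs by auto
  define body where "body = Seq G (Seq (clear out) (Seq (move t out) (Atom (Inc i))))"
  have keep: "map (\<sigma>(r := v)) xs = map \<sigma> xs" if "r \<notin> set xs" for \<sigma> :: "nat \<Rightarrow> nat" and r v
    using that by auto
  have xs': "c \<notin> set xs" "i \<notin> set xs" "t \<notin> set xs" "out \<notin> set xs"
    using xs regs by auto
  have body: "(\<sigma>, \<tau>) \<in> rsem body \<longleftrightarrow>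
      (\<exists>b. computes g (\<sigma> i # \<sigma> out # map \<sigma> xs) b \<and> \<tau> = \<sigma>(out := b, i := Suc (\<sigma> i)))"
    if \<sigma>: "\<forall>r\<ge>t. \<sigma> r = 0" for \<sigma> \<tau>
  proof -
    have 1: "(\<sigma>, \<rho>) \<in> rsem G \<longleftrightarrow>
        (\<exists>b. computes g (\<sigma> i # \<sigma> out # map \<sigma> xs) b \<and> \<rho> = \<sigma>(t := b))" for \<rho>
      using G \<sigma> regs by (simp add: realizes_def)
    have 2: "(\<sigma>(t := b), \<tau>) \<in> rsem (Seq (clear out) (Seq (move t out) (Atom (Inc i)))) \<longleftrightarrow>
        \<tau> = \<sigma>(out := b, i := Suc (\<sigma> i))" for b
    proof -
      have "(\<sigma>(t := b), \<tau>) \<in> rsem (Seq (clear out) (Seq (move t out) (Atom (Inc i)))) \<longleftrightarrow>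
          \<tau> = \<sigma>(t := b, out := 0, t := 0, out := b, i := Suc (\<sigma> i))"
        using regs by (simp add: rsem_clear rsem_move relcomp_unfold)
      also have "\<sigma>(t := b, out := 0, t := 0, out := b, i := Suc (\<sigma> i)) =
          \<sigma>(out := b, i := Suc (\<sigma> i))"
        using \<sigma> regs by (auto simp: fun_eq_iff)
      finally show ?thesis .
    qed
    have "(\<sigma>, \<tau>) \<in> rsem body \<longleftrightarrow> (\<exists>\<rho>. (\<sigma>, \<rho>) \<in> rsem G \<and>
        (\<rho>, \<tau>) \<in> rsem (Seq (clear out) (Seq (move t out) (Atom (Inc i)))))"
      unfolding body_def sem.simps(3)[of _ G] by blast
    then show ?thesis unfolding 1 2[symmetric] by blast
  qed
  have loop: "(\<sigma>, \<tau>) \<in> rsem (loop c body) \<longleftrightarrow>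
      (\<exists>y. iterates g (map \<sigma> xs) (\<sigma> i) (\<sigma> out) (\<sigma> c) y \<and>
         \<tau> = \<sigma>(out := y, i := \<sigma> i + \<sigma> c, c := 0))"
    if "\<forall>r\<ge>t. \<sigma> r = 0" for \<sigma> \<tau>
    using that
  proof (induction "\<sigma> c" arbitrary: \<sigma>)
    case 0
    then show ?case by (subst rsem_loop) auto
  next
    case (Suc n)
    have "(\<sigma>, \<tau>) \<in> rsem (loop c body) \<longleftrightarrow>
        (\<exists>\<rho>. (\<sigma>(c := n), \<rho>) \<in> rsem body \<and> (\<rho>, \<tau>) \<in> rsem (loop c body))"
      using Suc.hyps(2)[symmetric] by (subst rsem_loop) simp
    also have "\<dots> \<longleftrightarrow> (\<exists>b. computes g (\<sigma> i # \<sigma> out # map \<sigma> xs) b \<and>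
        (\<sigma>(c := n, out := b, i := Suc (\<sigma> i)), \<tau>) \<in> rsem (loop c body))"
      using Suc.prems regs xs' by (subst body) (auto simp: keep)
    also have "\<dots> \<longleftrightarrow> (\<exists>b. computes g (\<sigma> i # \<sigma> out # map \<sigma> xs) b \<and>
        (\<exists>y. iterates g (map \<sigma> xs) (Suc (\<sigma> i)) b n y \<and>
           \<tau> = \<sigma>(c := n, out := b, i := Suc (\<sigma> i), out := y, i := Suc (\<sigma> i) + n, c := 0)))"
    proof -
      have "(\<sigma>(c := n, out := b, i := Suc (\<sigma> i)), \<tau>) \<in> rsem (loop c body) \<longleftrightarrow>
        (\<exists>y. iterates g (map \<sigma> xs) (Suc (\<sigma> i)) b n y \<and>
           \<tau> = \<sigma>(c := n, out := b, i := Suc (\<sigma> i), out := y, i := Suc (\<sigma> i) + n, c := 0))" for b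
        using Suc.hyps(1)[of "\<sigma>(c := n, out := b, i := Suc (\<sigma> i))"] Suc.prems regs xs'
        by (simp add: keep)
      then show ?thesis by simp
    qed
    also have "\<dots> \<longleftrightarrow> (\<exists>y. iterates g (map \<sigma> xs) (\<sigma> i) (\<sigma> out) (\<sigma> c) y \<and>
        \<tau> = \<sigma>(out := y, i := \<sigma> i + \<sigma> c, c := 0))"
    proof -
      have "\<sigma>(c := n, out := b, i := Suc (\<sigma> i), out := y, i := Suc (\<sigma> i) + n, c := 0) =
          \<sigma>(out := y, i := \<sigma> i + \<sigma> c, c := 0)" for b y
        using Suc.hyps(2)[symmetric] by (auto simp: fun_eq_iff)
      then show ?thesis unfolding Suc.hyps(2)[symmetric] iterates.simps by auto
    qed
    finally show ?case .
  qed
  have "(\<sigma>, \<tau>) \<in> rsem (Seq (copy x c t) (Seq F (Seq (loop c body) (clear i)))) \<longleftrightarrow>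
      (\<exists>y. computes (PrimRec f g) (map \<sigma> ins) y \<and> \<tau> = \<sigma>(out := y))"
    if \<sigma>: "\<forall>r\<ge>m. \<sigma> r = 0" "\<sigma> out = 0" for \<sigma> \<tau>
  proof -
    have "(\<sigma>, \<tau>) \<in> rsem (Seq (copy x c t) (Seq F (Seq (loop c body) (clear i)))) \<longleftrightarrow>
        (\<sigma>(c := \<sigma> x), \<tau>) \<in> rsem (Seq F (Seq (loop c body) (clear i)))"
      using \<sigma> regs by (simp add: relcomp_unfold rsem_copy)
    also have "\<dots> \<longleftrightarrow> (\<exists>a. computes f (map \<sigma> xs) a \<and>
        (\<sigma>(c := \<sigma> x, out := a), \<tau>) \<in> rsem (Seq (loop c body) (clear i)))"
    proof -
      have "(\<sigma>(c := \<sigma> x), \<rho>) \<in> rsem F \<longleftrightarrow>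
          (\<exists>a. computes f (map \<sigma> xs) a \<and> \<rho> = \<sigma>(c := \<sigma> x, out := a))" for \<rho>
        using F \<sigma> regs xs' by (simp add: realizes_def keep)
      then show ?thesis by (auto simp: relcomp_unfold)
    qed
    also have "\<dots> \<longleftrightarrow> (\<exists>a. computes f (map \<sigma> xs) a \<and>
        (\<exists>y. iterates g (map \<sigma> xs) 0 a (\<sigma> x) y \<and> \<tau> = \<sigma>(out := y)))"
    proof -
      have \<sigma>ci: "\<sigma> c = 0" "\<sigma> i = 0" using \<sigma>(1) regs by auto
      have "(\<sigma>(c := \<sigma> x, out := a), \<rho>) \<in> rsem (loop c body) \<longleftrightarrow>
        (\<exists>y. iterates g (map \<sigma> xs) 0 a (\<sigma> x) y \<and>
          \<rho> = \<sigma>(c := \<sigma> x, out := a, out := y, i := \<sigma> x, c := 0))" for a \<rho>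
      proof -
        have "\<forall>r\<ge>t. (\<sigma>(c := \<sigma> x, out := a)) r = 0" using \<sigma>(1) regs by simp
        then have "(\<sigma>(c := \<sigma> x, out := a), \<rho>) \<in> rsem (loop c body) \<longleftrightarrow>
          (\<exists>y. iterates g (map (\<sigma>(c := \<sigma> x, out := a)) xs) 0 a (\<sigma> x) y \<and>
            \<rho> = \<sigma>(c := \<sigma> x, out := a, out := y, i := \<sigma> x, c := 0))"
          using \<sigma>ci regs loop[of "\<sigma>(c := \<sigma> x, out := a)" \<rho>] by simp
        then show ?thesis using xs' by (simp only: keep not_False_eq_True)
      qed
      moreover have "\<sigma>(c := \<sigma> x, out := a, out := y, i := \<sigma> x, c := 0, i := 0) = \<sigma>(out := y)" for a y
        using regs \<sigma>ci by (simp add: fun_eq_iff)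
      moreover have "(\<sigma>(c := \<sigma> x, out := a), \<tau>) \<in> rsem (Seq (loop c body) (clear i)) \<longleftrightarrow>
          (\<exists>\<rho>. (\<sigma>(c := \<sigma> x, out := a), \<rho>) \<in> rsem (loop c body) \<and> \<tau> = \<rho>(i := 0))" for a
        by (simp add: relcomp_unfold rsem_clear)
      ultimately have "(\<sigma>(c := \<sigma> x, out := a), \<tau>) \<in> rsem (Seq (loop c body) (clear i)) \<longleftrightarrow>
        (\<exists>y. iterates g (map \<sigma> xs) 0 a (\<sigma> x) y \<and> \<tau> = \<sigma>(out := y))" for a
        by metis
      then show ?thesis by simp
    qed
    also have "\<dots> \<longleftrightarrow> (\<exists>y. computes (PrimRec f g) (map \<sigma> ins) y \<and> \<tau> = \<sigma>(out := y))"
      using Cons by (auto simp: computes_PrimRec_iff)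
    finally show ?thesis .
  qed
  then show ?thesis unfolding realizes_def by blast
qed

lemma realizable_Mu:
  assumes f: "\<And>ins out m. set ins \<subseteq> {..<m} \<Longrightarrow> out < m \<Longrightarrow> out \<notin> set ins \<Longrightarrow>
      \<exists>P. realizes P f ins out m"
    and ins: "set ins \<subseteq> {..<m}" "out < m" "out \<notin> set ins"
  shows "\<exists>P. realizes P (Mu f) ins out m"
proof -
  have "set (out # ins) \<subseteq> {..<Suc m}" "m \<notin> set (out # ins)" using ins by auto
  then obtain F where F: "realizes F f (out # ins) m (Suc m)"
    using f[of "out # ins" "Suc m" m] by auto
  \<comment> \<open>Register \<open>m\<close> holds the value of \<open>f\<close> at the current
    candidate \<open>out\<close>. \<open>Dec m\<close> admits another round only if this value is
    positive; the final \<open>IsZero m\<close> lets the search stop only at a zero.\<close>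
  define S where "S = Seq (Atom (Dec m)) (Seq (clear m) (Seq (Atom (Inc out)) F))"
  have "(\<sigma>, \<tau>) \<in> rsem (Seq F (Seq (Star S) (Atom (IsZero m)))) \<longleftrightarrow>
      (\<exists>y. computes (Mu f) (map \<sigma> ins) y \<and> \<tau> = \<sigma>(out := y))"
    if \<sigma>: "\<forall>r\<ge>m. \<sigma> r = 0" "\<sigma> out = 0" for \<sigma> \<tau>
  proof -
    define xs where "xs = map \<sigma> ins"
    define st where "st k z = \<sigma>(out := k, m := z)" for k z
    have st_at: "st k z m = z" "st k z out = k" for k z using ins by (auto simp: st_def)
    have F': "(st k 0, \<rho>) \<in> rsem F \<longleftrightarrow> (\<exists>z. computes f (k # xs) z \<and> \<rho> = st k z)" for k \<rho>
    proof -
      have "map (st k 0) (out # ins) = k # xs" using ins by (auto simp: st_def xs_def)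
      moreover have "\<forall>r\<ge>Suc m. st k 0 r = 0" "st k 0 m = 0" using \<sigma> ins by (auto simp: st_def)
      moreover have "(st k 0)(m := z) = st k z" for z by (simp add: st_def)
      ultimately show ?thesis using F unfolding realizes_def by metis
    qed
    have S': "(st k z, \<rho>) \<in> rsem S \<longleftrightarrow>
        z > 0 \<and> (\<exists>z'. computes f (Suc k # xs) z' \<and> \<rho> = st (Suc k) z')" for k z \<rho>
    proof -
      have "(st k z)(m := z - 1, m := 0, out := Suc k) = st (Suc k) 0"
        using ins by (auto simp: st_def fun_eq_iff)
      then have "(st k z, \<rho>) \<in> rsem S \<longleftrightarrow> z > 0 \<and> (st (Suc k) 0, \<rho>) \<in> rsem F"
        using ins by (auto simp: S_def relcomp_unfold rsem_clear st_at)
      then show ?thesis unfolding F' .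
    qed
    have sound: "\<exists>k z. \<rho> = st k z \<and> computes f (k # xs) z \<and>
        (\<forall>j<k. \<exists>z. computes f (j # xs) (Suc z))"
      if "(st 0 z0, \<rho>) \<in> (rsem S)\<^sup>*" "computes f (0 # xs) z0" for z0 \<rho>
      using that
    proof (induction rule: rtrancl_induct)
      case base
      then show ?case by blast
    next
      case (step \<rho> \<rho>')
      then obtain k z where k: "\<rho> = st k z" "computes f (k # xs) z"
          "\<forall>j<k. \<exists>z. computes f (j # xs) (Suc z)" by blast
      with step.hyps(2) obtain z' where z': "z > 0" "computes f (Suc k # xs) z'" "\<rho>' = st (Suc k) z'"
        using S' by auto
      have "\<forall>j<Suc k. \<exists>z. computes f (j # xs) (Suc z)"
        using k z'(1) by (metis less_Suc_eq gr0_implies_Suc)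
      with z' show ?case by blast
    qed
    have complete: "\<exists>z0. computes f (0 # xs) z0 \<and> (st 0 z0, st k z) \<in> (rsem S)\<^sup>*"
      if "computes f (k # xs) z" "\<forall>j<k. \<exists>z. computes f (j # xs) (Suc z)" for k z
      using that
    proof (induction k arbitrary: z)
      case (Suc k)
      then obtain u where u: "computes f (k # xs) (Suc u)" by blast
      with Suc obtain z0 where z0: "computes f (0 # xs) z0" "(st 0 z0, st k (Suc u)) \<in> (rsem S)\<^sup>*"
        by (metis less_Suc_eq)
      have "(st k (Suc u), st (Suc k) z) \<in> rsem S" using S' Suc.prems by blast
      with z0 show ?case by (meson rtrancl.rtrancl_into_rtrancl)
    qed auto
    have st0: "\<sigma> = st 0 0" using \<sigma> ins by (auto simp: st_def fun_eq_iff)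
    have stn: "st n 0 = \<sigma>(out := n)" for n using \<sigma> ins by (auto simp: st_def fun_eq_iff)
    have "(\<sigma>, \<tau>) \<in> rsem (Seq F (Seq (Star S) (Atom (IsZero m)))) \<longleftrightarrow>
        (\<exists>z0. computes f (0 # xs) z0 \<and> (st 0 z0, \<tau>) \<in> (rsem S)\<^sup>* \<and> \<tau> m = 0)"
      using F'[of 0] unfolding st0[symmetric] by (auto simp: relcomp_unfold)
    also have "\<dots> \<longleftrightarrow> (\<exists>n. computes f (n # xs) 0 \<and> (\<forall>j<n. \<exists>z. computes f (j # xs) (Suc z)) \<and>
        \<tau> = st n 0)"
      using sound complete st_at by metis
    also have "\<dots> \<longleftrightarrow> (\<exists>y. computes (Mu f) (map \<sigma> ins) y \<and> \<tau> = \<sigma>(out := y))"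
      unfolding computes_Mu_iff stn xs_def by auto
    finally show ?thesis .
  qed
  then show ?thesis unfolding realizes_def by blast
qed

theorem realizable:
  "set ins \<subseteq> {..<m} \<Longrightarrow> out < m \<Longrightarrow> out \<notin> set ins \<Longrightarrow> \<exists>P. realizes P f ins out m"
proof (induction f arbitrary: ins out m)
  case Zero
  then show ?case using realizable_Zero by blast
next
  case (Comp f gs)
  show ?case by (rule realizable_Comp) (use Comp in blast)+
next
  case (PrimRec f g)
  show ?case by (rule realizable_PrimRec) (use PrimRec in blast)+
next
  case (Mu f)
  show ?case by (rule realizable_Mu) (use Mu in blast)+
qed (simp_all add: realizable_Succ realizable_Proj)

section \<open>Arithmetic programs\<close>

text \<open>An equation rather than an assignment: division by \<open>p\<close> is
  \<open>n = p * n'\<close>, which has no solution when \<open>p\<close> does not divide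
  \<open>n\<close>. Equality of two exponents is also what the automaton can check.\<close>

datatype affine = Affine (src_mul: nat) (src_add: nat) (tgt_mul: nat) (tgt_add: nat)

definition affine_rel :: "affine \<Rightarrow> nat rel" where
  "affine_rel e = {(n, n'). src_mul e * n + src_add e = tgt_mul e * n' + tgt_add e}"

abbreviation "asem \<equiv> sem affine_rel"

text \<open>
  A nondeterministic zero test: guess the residue \<open>s\<close> of \<open>n\<close> modulo \<open>p\<close>, go from \<open>n = p * m + s\<close>
  to \<open>m\<close>, and back again.
\<close>

fun nondiv_upto :: "nat \<Rightarrow> nat \<Rightarrow> affine prog" where
  "nondiv_upto p 0 = Atom (Affine 0 0 0 1)"
| "nondiv_upto p (Suc s) =
     Alt (nondiv_upto p s) (Seq (Atom (Affine 1 0 p (Suc s))) (Atom (Affine p (Suc s) 1 0)))"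

text \<open>The base program is the unsolvable equation 0 = 1, so only residues from 1 to
  \<open>k\<close> are guessed. Going back with the same residue restores \<open>n\<close>.\<close>

lemma asem_nondiv_upto:
  "(n, n') \<in> asem (nondiv_upto p k) \<longleftrightarrow> n' = n \<and> (\<exists>s. 0 < s \<and> s \<le> k \<and> (\<exists>m. n = p * m + s))"
  by (induction k) (auto simp: affine_rel_def relcomp_unfold le_Suc_eq)

lemma asem_nondiv:
  assumes "p > 0"
  shows "(n, n') \<in> asem (nondiv_upto p (p - 1)) \<longleftrightarrow> n' = n \<and> \<not> p dvd n"
proof -
  have "(\<exists>s. 0 < s \<and> s \<le> p - 1 \<and> (\<exists>m. n = p * m + s)) \<longleftrightarrow> \<not> p dvd n"
  proof
    assume "\<exists>s. 0 < s \<and> s \<le> p - 1 \<and> (\<exists>m. n = p * m + s)"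
    then obtain s m where "0 < s" "s < p" "n = p * m + s" using assms by (auto simp: less_eq_Suc_le)
    then show "\<not> p dvd n" by (auto simp: dvd_eq_mod_eq_0)
  next
    assume "\<not> p dvd n"
    then have "0 < n mod p" "n mod p \<le> p - 1" "n = p * (n div p) + n mod p"
      using mod_less_divisor[OF assms, of n] by (auto simp: dvd_eq_mod_eq_0)
    then show "\<exists>s. 0 < s \<and> s \<le> p - 1 \<and> (\<exists>m. n = p * m + s)" by blast
  qed
  then show ?thesis by (simp add: asem_nondiv_upto)
qed

definition nth_prime :: "nat \<Rightarrow> nat" where
  "nth_prime = enumerate {p. prime p}"

lemma prime_nth_prime: "prime (nth_prime r)"
  using enumerate_in_set[OF primes_infinite] by (simp add: nth_prime_def)

lemma nth_prime_eq_iff: "nth_prime r = nth_prime s \<longleftrightarrow> r = s"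
  using strict_mono_enumerate[OF primes_infinite]
  by (simp add: nth_prime_def strict_mono_eq)

definition reg_code :: "nat \<Rightarrow> (nat \<Rightarrow> nat) \<Rightarrow> nat" where
  "reg_code K \<sigma> = (\<Prod>r<K. nth_prime r ^ \<sigma> r)"

lemma reg_code_Inc:
  assumes "r < K"
  shows "reg_code K (\<sigma>(r := Suc (\<sigma> r))) = nth_prime r * reg_code K \<sigma>"
proof -
  have "reg_code K \<tau> = nth_prime r ^ \<tau> r * (\<Prod>r\<in>{..<K} - {r}. nth_prime r ^ \<tau> r)" for \<tau>
    using assms by (simp add: reg_code_def prod.remove)
  moreover have "(\<Prod>s\<in>{..<K} - {r}. nth_prime s ^ (\<sigma>(r := Suc (\<sigma> r))) s) =
      (\<Prod>s\<in>{..<K} - {r}. nth_prime s ^ \<sigma> s)"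
    by (rule prod.cong) auto
  ultimately show ?thesis by simp
qed

lemma nth_prime_dvd_reg_code_iff:
  assumes "r < K"
  shows "nth_prime r dvd reg_code K \<sigma> \<longleftrightarrow> \<sigma> r > 0"
proof
  assume "nth_prime r dvd reg_code K \<sigma>"
  then obtain s where s: "s < K" "nth_prime r dvd nth_prime s ^ \<sigma> s"
    using prime_nth_prime by (auto simp: reg_code_def prime_dvd_prod_iff)
  then have "nth_prime r dvd nth_prime s" by (meson prime_dvd_power prime_nth_prime)
  then have "r = s" using primes_dvd_imp_eq[OF prime_nth_prime prime_nth_prime] nth_prime_eq_iff by blast
  with s show "\<sigma> r > 0" using prime_nth_prime[of s] by (cases "\<sigma> r") auto
next
  assume "\<sigma> r > 0"
  then have "\<sigma> = (\<sigma>(r := \<sigma> r - 1))(r := Suc ((\<sigma>(r := \<sigma> r - 1)) r))" by auto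
  then show "nth_prime r dvd reg_code K \<sigma>" using reg_code_Inc[OF assms] by (metis dvd_triv_left)
qed

fun arith_prog :: "reg_op prog \<Rightarrow> affine prog" where
  "arith_prog (Atom (Inc r)) = Atom (Affine (nth_prime r) 0 1 0)"
| "arith_prog (Atom (Dec r)) = Atom (Affine 1 0 (nth_prime r) 0)"
| "arith_prog (Atom (IsZero r)) = nondiv_upto (nth_prime r) (nth_prime r - 1)"
| "arith_prog (Alt P Q) = Alt (arith_prog P) (arith_prog Q)"
| "arith_prog (Seq P Q) = Seq (arith_prog P) (arith_prog Q)"
| "arith_prog (Star P) = Star (arith_prog P)"

fun reg_bound :: "reg_op prog \<Rightarrow> nat" where
  "reg_bound (Atom (Inc r)) = Suc r"
| "reg_bound (Atom (Dec r)) = Suc r"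
| "reg_bound (Atom (IsZero r)) = Suc r"
| "reg_bound (Alt P Q) = max (reg_bound P) (reg_bound Q)"
| "reg_bound (Seq P Q) = max (reg_bound P) (reg_bound Q)"
| "reg_bound (Star P) = reg_bound P"

text \<open>Started on a code, an arithmetic program stays among codes of register states; this
  carries the equivalence through \<open>Seq\<close> and \<open>Star\<close>. One \<open>K\<close>
  bounds the registers of all subprograms.\<close>

lemma asem_arith_prog:
  assumes "reg_bound P \<le> K"
  shows "(reg_code K \<sigma>, n') \<in> asem (arith_prog P) \<longleftrightarrow>
    (\<exists>\<tau>. (\<sigma>, \<tau>) \<in> rsem P \<and> n' = reg_code K \<tau>)"
  using assms
proof (induction P arbitrary: \<sigma> n' rule: arith_prog.induct)
  case (1 r)
  then show ?case by (auto simp: affine_rel_def reg_code_Inc)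
next
  case (2 r)
  have r: "r < K" using 2 by simp
  have pos: "nth_prime r > 0" using prime_gt_0_nat[OF prime_nth_prime] .
  show ?case
  proof (cases "\<sigma> r > 0")
    case True
    define \<tau> where "\<tau> = \<sigma>(r := \<sigma> r - 1)"
    have "\<sigma> = \<tau>(r := Suc (\<tau> r))" using True by (auto simp: \<tau>_def)
    then have "reg_code K \<sigma> = nth_prime r * reg_code K \<tau>" using reg_code_Inc[OF r] by metis
    then show ?thesis using True pos by (auto simp: affine_rel_def \<tau>_def)
  next
    case False
    then have "\<not> nth_prime r dvd reg_code K \<sigma>" using nth_prime_dvd_reg_code_iff[OF r] by simp
    then show ?thesis using False by (auto simp: affine_rel_def)
  qed
next
  case (3 r)
  then show ?case
    using prime_gt_0_nat[OF prime_nth_prime[of r]]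
    by (auto simp: asem_nondiv nth_prime_dvd_reg_code_iff simp del: One_nat_def)
next
  case (5 P Q)
  then show ?case by (fastforce simp: relcomp_unfold)
next
  case (6 P)
  then have IH: "(reg_code K \<sigma>, n') \<in> asem (arith_prog P) \<longleftrightarrow>
    (\<exists>\<tau>. (\<sigma>, \<tau>) \<in> rsem P \<and> n' = reg_code K \<tau>)" for \<sigma> n' by simp
  have "\<exists>\<tau>. (\<sigma>, \<tau>) \<in> (rsem P)\<^sup>* \<and> n' = reg_code K \<tau>"
    if "(reg_code K \<sigma>, n') \<in> (asem (arith_prog P))\<^sup>*"
    using that
  proof (induction rule: rtrancl_induct)
    case (step y z)
    then show ?case using IH by (meson rtrancl.rtrancl_into_rtrancl)
  qed auto
  moreover have "(reg_code K \<sigma>, reg_code K \<tau>) \<in> (asem (arith_prog P))\<^sup>*"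
    if "(\<sigma>, \<tau>) \<in> (rsem P)\<^sup>*" for \<tau>
    using that
  proof (induction rule: rtrancl_induct)
    case (step y z)
    then have "(reg_code K y, reg_code K z) \<in> asem (arith_prog P)" using IH by blast
    with step.IH show ?case by (rule rtrancl_into_rtrancl)
  qed auto
  ultimately show ?case by auto
qed auto

theorem computes_by_arith_prog:
  "\<exists>P. \<forall>xs. length xs = L \<longrightarrow>
     ((\<exists>y. computes f xs y) \<longleftrightarrow> (\<exists>n'. (\<Prod>r<L. nth_prime r ^ (xs ! r), n') \<in> asem P))"
proof -
  have "set [0..<L] \<subseteq> {..<Suc L}" by auto
  then obtain P where P: "realizes P f [0..<L] L (Suc L)"
    using realizable[of "[0..<L]" "Suc L" L f] by auto
  define K where "K = max L (reg_bound P)"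
  have "(\<exists>y. computes f xs y) \<longleftrightarrow>
      (\<exists>n'. (\<Prod>r<L. nth_prime r ^ (xs ! r), n') \<in> asem (arith_prog P))"
    if xs: "length xs = L" for xs
  proof -
    define \<sigma> where "\<sigma> r = (if r < L then xs ! r else 0)" for r
    have \<sigma>: "\<forall>r\<ge>Suc L. \<sigma> r = 0" "\<sigma> L = 0" by (auto simp: \<sigma>_def)
    have map: "map \<sigma> [0..<L] = xs" using xs by (auto simp: \<sigma>_def intro: nth_equalityI)
    \<comment> \<open>Registers from \<open>L\<close> on hold 0 and contribute the factor 1.\<close>
    have "(\<Prod>r<L. nth_prime r ^ (xs ! r)) = (\<Prod>r<K. nth_prime r ^ \<sigma> r)"
      by (rule prod.mono_neutral_cong_left) (auto simp: \<sigma>_def K_def)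
    then have "(\<exists>n'. (\<Prod>r<L. nth_prime r ^ (xs ! r), n') \<in> asem (arith_prog P)) \<longleftrightarrow>
        (\<exists>\<tau>. (\<sigma>, \<tau>) \<in> rsem P)"
      using asem_arith_prog[of P K \<sigma>] by (auto simp: reg_code_def K_def)
    also have "\<dots> \<longleftrightarrow> (\<exists>y. computes f xs y)"
      using P \<sigma> unfolding realizes_def map[symmetric] by auto
    finally show ?thesis ..
  qed
  then show ?thesis by blast
qed

section \<open>Control flow as a finite edge system\<close>

datatype 'q edge = Edge (source: 'q) (label: affine) (target: 'q)

inductive accepts :: "'q edge set \<Rightarrow> 'q \<Rightarrow> 'q \<Rightarrow> nat \<Rightarrow> bool" for E qf where
  stop: "accepts E qf qf n"
| step: "e \<in> E \<Longrightarrow> (n, n') \<in> affine_rel (label e) \<Longrightarrow> accepts E qf (target e) n' \<Longrightarrow>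
    accepts E qf (source e) n"

text \<open>Control states are continuations; \<open>Affine 1 0 1 0\<close> is the identity relation.\<close>

fun cont_steps :: "affine prog list \<Rightarrow> (affine \<times> affine prog list) set" where
  "cont_steps [] = {}"
| "cont_steps (Atom e # c) = {(e, c)}"
| "cont_steps (Alt P Q # c) = {(Affine 1 0 1 0, P # c), (Affine 1 0 1 0, Q # c)}"
| "cont_steps (Seq P Q # c) = {(Affine 1 0 1 0, P # Q # c)}"
| "cont_steps (Star P # c) = {(Affine 1 0 1 0, c), (Affine 1 0 1 0, P # Star P # c)}"

text \<open>Similar to the partial derivatives of a regular expression: one continuation for each
  occurrence of a subprogram, hence finitely many. A star body returns to the same
  \<open>Star P # c\<close>, so the lists do not grow.\<close>

fun reachable_conts :: "affine prog \<Rightarrow> affine prog list \<Rightarrow> affine prog list set" where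
  "reachable_conts (Atom e) c = {Atom e # c}"
| "reachable_conts (Alt P Q) c = {Alt P Q # c} \<union> reachable_conts P c \<union> reachable_conts Q c"
| "reachable_conts (Seq P Q) c =
     {Seq P Q # c} \<union> reachable_conts P (Q # c) \<union> reachable_conts Q c"
| "reachable_conts (Star P) c = {Star P # c} \<union> reachable_conts P (Star P # c)"

lemma finite_reachable_conts: "finite (reachable_conts P c)"
  by (induction P arbitrary: c) auto

lemma reachable_conts_self: "P # c \<in> reachable_conts P c"
  by (cases P) auto

definition prog_edges :: "affine prog \<Rightarrow> affine prog list edge set" where
  "prog_edges P = {Edge x e y | x e y. x \<in> reachable_conts P [] \<and> (e, y) \<in> cont_steps x}"

lemma finite_prog_edges: "finite (prog_edges P)"
proof -
  have "finite (cont_steps x)" for x by (cases x rule: cont_steps.cases) auto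
  then have "finite (\<Union>x\<in>reachable_conts P []. (\<lambda>(e, y). Edge x e y) ` cont_steps x)"
    using finite_reachable_conts by blast
  then show ?thesis by (rule finite_subset[rotated]) (auto simp: prog_edges_def)
qed

text \<open>The end of a computation is marked by an edge letter, so some edge must exist even for a
  computation without steps.\<close>

lemma prog_edges_nonempty: "prog_edges P \<noteq> {}"
proof -
  have "cont_steps [P] \<noteq> {}" by (cases P) auto
  then obtain e y where "(e, y) \<in> cont_steps [P]" by fastforce
  then have "Edge [P] e y \<in> prog_edges P"
    using reachable_conts_self by (auto simp: prog_edges_def)
  then show ?thesis by blast
qed

primrec cont_sem :: "affine prog list \<Rightarrow> nat rel" where
  "cont_sem [] = Id"
| "cont_sem (P # c) = asem P O cont_sem c"

lemma affine_rel_Id: "affine_rel (Affine (Suc 0) 0 (Suc 0) 0) = Id"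
  by (auto simp: affine_rel_def)

lemma cont_step_sound:
  "(e, y) \<in> cont_steps x \<Longrightarrow> affine_rel e O cont_sem y \<subseteq> cont_sem x"
proof (cases x rule: cont_steps.cases)
  case (5 P c)
  moreover assume "(e, y) \<in> cont_steps x"
  ultimately have "(e = Affine 1 0 1 0 \<and> y = c) \<or> (e = Affine 1 0 1 0 \<and> y = P # Star P # c)"
    by auto
  then show ?thesis
    using 5 by (auto simp: affine_rel_Id) (blast intro: converse_rtrancl_into_rtrancl)
qed (auto simp: affine_rel_Id)

lemma accepts_sound:
  "accepts (prog_edges P) [] x n \<Longrightarrow> \<exists>n'. (n, n') \<in> cont_sem x"
proof (induction rule: accepts.induct)
  case (step e n n')
  then obtain n'' where "(n', n'') \<in> cont_sem (target e)" by blast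
  moreover have "(label e, target e) \<in> cont_steps (source e)"
    using step.hyps(1) by (auto simp: prog_edges_def)
  ultimately show ?case using cont_step_sound step.hyps(2) by blast
qed auto

lemma accepts_cont_step:
  assumes "x \<in> reachable_conts P []" "(e, y) \<in> cont_steps x" "(n, n') \<in> affine_rel e"
    "accepts (prog_edges P) [] y n'"
  shows "accepts (prog_edges P) [] x n"
  using accepts.step[of "Edge x e y" "prog_edges P" n n' "[]"] assms by (auto simp: prog_edges_def)

lemma accepts_eps:
  assumes "x \<in> reachable_conts P []" "(Affine 1 0 1 0, y) \<in> cont_steps x"
    "accepts (prog_edges P) [] y n"
  shows "accepts (prog_edges P) [] x n"
  using accepts_cont_step[OF assms(1,2)] assms(3) by (auto simp: affine_rel_Id)

text \<open>Stated for an arbitrary continuation \<open>c\<close>, so that \<open>Seq\<close> and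
  \<open>Star\<close> can push further programs in front of it. The inclusion guarantees that the
  edges for \<open>Q\<close> are present.\<close>

lemma accepts_complete:
  assumes "(n, n') \<in> asem Q" "reachable_conts Q c \<subseteq> reachable_conts P []"
    "accepts (prog_edges P) [] c n'"
  shows "accepts (prog_edges P) [] (Q # c) n"
  using assms
proof (induction Q arbitrary: c n n')
  case (Atom e)
  then show ?case using accepts_cont_step[of "Atom e # c"] by auto
next
  case (Alt Q R)
  have "accepts (prog_edges P) [] (Q # c) n \<or> accepts (prog_edges P) [] (R # c) n"
    using Alt by auto
  then show ?case using accepts_eps[of "Alt Q R # c"] Alt.prems(2) by auto
next
  case (Seq Q R)
  have "accepts (prog_edges P) [] (Q # R # c) n"
    using Seq by auto
  then show ?case using accepts_eps[of "Seq Q R # c"] Seq.prems(2) by auto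
next
  case (Star Q)
  from Star.prems(1) have "(n, n') \<in> (asem Q)\<^sup>*" by simp
  then show ?case
  proof (induction rule: converse_rtrancl_induct)
    case base
    then show ?case using accepts_eps[of "Star Q # c"] Star.prems by auto
  next
    case (step n m)
    then have "accepts (prog_edges P) [] (Q # Star Q # c) n" using Star by auto
    then show ?case using accepts_eps[of "Star Q # c"] Star.prems by auto
  qed
qed

theorem accepts_prog_edges_iff:
  "accepts (prog_edges P) [] [P] n \<longleftrightarrow> (\<exists>n'. (n, n') \<in> asem P)"
proof
  assume "\<exists>n'. (n, n') \<in> asem P"
  then obtain n' where "(n, n') \<in> asem P" ..
  then show "accepts (prog_edges P) [] [P] n" by (rule accepts_complete) (auto intro: accepts.stop)
next
  assume "accepts (prog_edges P) [] [P] n"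
  from accepts_sound[OF this] show "\<exists>n'. (n, n') \<in> asem P" by auto
qed

section \<open>Values and run counts of probabilistic automata\<close>

fun state_value :: "('a, 'q) pa \<Rightarrow> 'a list \<Rightarrow> 'q \<Rightarrow> rat" where
  "state_value A [] q = (if q \<in> final A then 1 else 0)"
| "state_value A (a # w) q = (\<Sum>p\<in>states A. delta A q a p * state_value A w p)"

fun state_runs :: "('a, 'q) pa \<Rightarrow> 'a list \<Rightarrow> 'q \<Rightarrow> nat" where
  "state_runs A [] q = (if q \<in> final A then 1 else 0)"
| "state_runs A (a # w) q = (\<Sum>p\<in>{p \<in> states A. delta A q a p > 0}. state_runs A w p)"

definition runs_from :: "('a, 'q) pa \<Rightarrow> 'a list \<Rightarrow> 'q \<Rightarrow> 'q list set" where
  "runs_from A w q = {qs. is_run A w qs \<and> hd qs = q \<and> last qs \<in> final A}"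

lemma runs_from_Nil:
  "q \<in> states A \<Longrightarrow> runs_from A [] q = (if q \<in> final A then {[q]} else {})"
  by (auto simp: runs_from_def is_run_def length_Suc_conv)

lemma is_run_Cons:
  "is_run A (a # w) qs \<longleftrightarrow>
     (\<exists>q ps. qs = q # ps \<and> q \<in> states A \<and> is_run A w ps \<and> delta A q a (hd ps) > 0)"
proof (cases qs)
  case (Cons q ps)
  show ?thesis
  proof (cases ps)
    case Nil
    with Cons show ?thesis by (simp add: is_run_def)
  next
    case (Cons p ps')
    with \<open>qs = q # ps\<close> show ?thesis
      by (auto simp: is_run_def less_Suc_eq_0_disj)
  qed
qed (simp add: is_run_def)

lemma runs_from_Cons:
  assumes "q \<in> states A"
  shows "runs_from A (a # w) q =
    (\<Union>p\<in>{p \<in> states A. delta A q a p > 0}. (#) q ` runs_from A w p)"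
proof -
  have "ps \<noteq> [] \<and> hd ps \<in> states A" if "is_run A w ps" for ps
    using that by (auto simp: is_run_def length_Suc_conv)
  then show ?thesis
    using assms by (fastforce simp: runs_from_def is_run_Cons)
qed

lemma finite_runs_from: "finite (states A) \<Longrightarrow> finite (runs_from A w q)"
  by (rule finite_subset[of _ "{qs. set qs \<subseteq> states A \<and> length qs = Suc (length w)}"])
    (auto simp: runs_from_def is_run_def intro: finite_lists_length_eq)

lemma sum_runs_from_Cons:
  fixes F :: "'q list \<Rightarrow> 'c::comm_monoid_add"
  assumes "finite (states A)" "q \<in> states A"
  shows "sum F (runs_from A (a # w) q) =
    (\<Sum>p\<in>{p \<in> states A. delta A q a p > 0}. \<Sum>ps\<in>runs_from A w p. F (q # ps))"
proof -
  have "sum F (runs_from A (a # w) q) =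
      (\<Sum>p\<in>{p \<in> states A. delta A q a p > 0}. sum F ((#) q ` runs_from A w p))"
    unfolding runs_from_Cons[OF assms(2)]
    by (rule sum.UNION_disjoint)
      (use assms(1) in \<open>simp_all add: finite_runs_from\<close>, auto simp: runs_from_def)
  also have "\<dots> = (\<Sum>p\<in>{p \<in> states A. delta A q a p > 0}. \<Sum>ps\<in>runs_from A w p. F (q # ps))"
    by (simp add: sum.reindex)
  finally show ?thesis .
qed

lemma card_runs_from:
  assumes "finite (states A)" "q \<in> states A"
  shows "card (runs_from A w q) = state_runs A w q"
  using assms(2)
proof (induction w arbitrary: q)
  case (Cons a w)
  then show ?case
    using sum_runs_from_Cons[OF assms(1) Cons.prems, of "\<lambda>_. 1::nat" a w] by simp
qed (simp add: runs_from_Nil)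

text \<open>Runs use only positive transitions while \<open>state_value\<close> sums over all
  states; nonnegativity makes the missing terms 0. It is available only for letters of the alphabet,
  hence the restriction on \<open>w\<close>.\<close>

lemma sum_prob_runs_from:
  assumes A: "is_pa A" and "w \<in> lists (alphabet A)" "q \<in> states A"
  shows "(\<Sum>qs\<in>runs_from A w q. \<Prod>i<length w. delta A (qs ! i) (w ! i) (qs ! Suc i)) =
    state_value A w q"
  using assms(2,3)
proof (induction w arbitrary: q)
  case (Cons a w)
  have fin: "finite (states A)" using A by (simp add: is_pa_def)
  have nonneg: "0 \<le> delta A q a p" if "p \<in> states A" for p
  proof -
    have "a \<in> alphabet A" using Cons.hyps by simp
    then show ?thesis using A Cons.prems that by (auto simp: is_pa_def distribution_on_def)
  qed
  have "(\<Sum>qs\<in>runs_from A (a # w) q.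
      \<Prod>i<length (a # w). delta A (qs ! i) ((a # w) ! i) (qs ! Suc i)) =
    (\<Sum>p\<in>{p \<in> states A. delta A q a p > 0}. \<Sum>ps\<in>runs_from A w p.
      delta A q a p * (\<Prod>i<length w. delta A (ps ! i) (w ! i) (ps ! Suc i)))"
  proof (subst sum_runs_from_Cons[OF fin Cons.prems], intro sum.cong refl)
    fix p ps assume "ps \<in> runs_from A w p"
    then have "ps ! 0 = p" by (auto simp: runs_from_def is_run_def length_Suc_conv)
    then show "(\<Prod>i<length (a # w). delta A ((q # ps) ! i) ((a # w) ! i) ((q # ps) ! Suc i)) =
        delta A q a p * (\<Prod>i<length w. delta A (ps ! i) (w ! i) (ps ! Suc i))"
      by (simp add: prod.lessThan_Suc_shift del: prod.lessThan_Suc)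
  qed
  also have "\<dots> = (\<Sum>p\<in>{p \<in> states A. delta A q a p > 0}. delta A q a p * state_value A w p)"
    using Cons by (auto simp: sum_distrib_left[symmetric] intro!: sum.cong)
  also have "\<dots> = state_value A (a # w) q"
    using fin nonneg by (auto intro!: sum.mono_neutral_cong_left simp: antisym_conv2 less_le)
  finally show ?case .
qed (simp add: runs_from_Nil)

lemma accepting_runs_eq:
  assumes "is_pa A"
  shows "accepting_runs A w = (\<Union>q\<in>{q \<in> states A. init A q > 0}. runs_from A w q)"
proof -
  have "hd ps \<in> states A" if "is_run A w ps" for ps
    using that by (auto simp: is_run_def length_Suc_conv)
  then show ?thesis by (auto simp: accepting_runs_def runs_from_def)
qed

lemma sum_accepting_runs:
  fixes F :: "'q list \<Rightarrow> 'c::comm_monoid_add"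
  assumes A: "is_pa A"
  shows "sum F (accepting_runs A w) =
    (\<Sum>q\<in>{q \<in> states A. init A q > 0}. sum F (runs_from A w q))"
  unfolding accepting_runs_eq[OF A]
  by (rule sum.UNION_disjoint)
    (use A in \<open>simp_all add: is_pa_def finite_runs_from\<close>, auto simp: runs_from_def)

lemma acc_prob_eq_state_value:
  assumes A: "is_pa A" and w: "w \<in> lists (alphabet A)"
  shows "acc_prob A w = (\<Sum>q\<in>states A. init A q * state_value A w q)"
proof -
  have "acc_prob A w = (\<Sum>q\<in>{q \<in> states A. init A q > 0}. \<Sum>qs\<in>runs_from A w q.
      init A q * (\<Prod>i<length w. delta A (qs ! i) (w ! i) (qs ! Suc i)))"
    unfolding acc_prob_def sum_accepting_runs[OF A]
    by (intro sum.cong refl) (auto simp: run_prob_def runs_from_def)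
  also have "\<dots> = (\<Sum>q\<in>{q \<in> states A. init A q > 0}. init A q * state_value A w q)"
    by (intro sum.cong refl)
      (simp add: sum_distrib_left[symmetric] sum_prob_runs_from[OF A w])
  also have "\<dots> = (\<Sum>q\<in>states A. init A q * state_value A w q)"
    using A by (intro sum.mono_neutral_left)
      (auto simp: is_pa_def distribution_on_def antisym_conv2 less_le)
  finally show ?thesis .
qed

lemma card_accepting_runs:
  assumes A: "is_pa A"
  shows "card (accepting_runs A w) = (\<Sum>q\<in>{q \<in> states A. init A q > 0}. state_runs A w q)"
proof -
  have "card (accepting_runs A w) =
      (\<Sum>q\<in>{q \<in> states A. init A q > 0}. card (runs_from A w q))"
    using sum_accepting_runs[OF A, of "\<lambda>_. 1::nat" w] by simp
  also have "\<dots> = (\<Sum>q\<in>{q \<in> states A. init A q > 0}. state_runs A w q)"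
    using A by (intro sum.cong refl card_runs_from) (auto simp: is_pa_def)
  finally show ?thesis .
qed

section \<open>Invariance under renaming of states\<close>

lemma state_value_iso:
  assumes g: "bij_betw g (states A) (states B)" and "final B = g ` final A" "final A \<subseteq> states A"
    and "\<And>q a p. q \<in> states A \<Longrightarrow> a \<in> X \<Longrightarrow> p \<in> states A \<Longrightarrow>
      delta B (g q) a (g p) = delta A q a p"
    and "w \<in> lists X" "q \<in> states A"
  shows "state_value B w (g q) = state_value A w q"
  using assms(5,6)
proof (induction w arbitrary: q)
  case Nil
  then show ?case using assms(1-3) by (auto simp: bij_betw_def inj_on_def)
next
  case (Cons a w)
  have "state_value B (a # w) (g q) =
      (\<Sum>p\<in>states A. delta B (g q) a (g p) * state_value B w (g p))"
    using sum.reindex_bij_betw[OF g, of "\<lambda>p. delta B (g q) a p * state_value B w p"] by simp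
  then show ?case using Cons assms(4) by simp
qed

lemma state_runs_iso:
  assumes g: "bij_betw g (states A) (states B)" and "final B = g ` final A" "final A \<subseteq> states A"
    and "\<And>q a p. q \<in> states A \<Longrightarrow> a \<in> X \<Longrightarrow> p \<in> states A \<Longrightarrow>
      delta B (g q) a (g p) = delta A q a p"
    and "w \<in> lists X" "q \<in> states A"
  shows "state_runs B w (g q) = state_runs A w q"
  using assms(5,6)
proof (induction w arbitrary: q)
  case Nil
  then show ?case using assms(1-3) by (auto simp: bij_betw_def inj_on_def)
next
  case (Cons a w)
  have "bij_betw g {p \<in> states A. delta A q a p > 0} {p \<in> states B. delta B (g q) a p > 0}"
  proof -
    have "a \<in> X" using Cons.hyps by simp
    then have \<delta>: "delta B (g q) a (g p) = delta A q a p" if "p \<in> states A" for p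
      using assms(4) Cons.prems that by blast
    then have "{p \<in> states B. delta B (g q) a p > 0} = g ` {p \<in> states A. delta A q a p > 0}"
      using g by (fastforce simp: bij_betw_def)
    then show ?thesis using g by (auto simp: bij_betw_def inj_on_def)
  qed
  from sum.reindex_bij_betw[OF this, of "state_runs B w", symmetric]
  show ?case using Cons by simp
qed

section \<open>Checking a computation by probabilities\<close>

text \<open>
  The letter 0 is a unary digit and the letter \<open>Suc r\<close> selects the edge \<open>es ! r\<close>. The word
  \<open>Suc r\<^sub>1, 0\<^bsup>n\<^sub>1\<^esup>, Suc r\<^sub>2, 0\<^bsup>n\<^sub>2\<^esup>, \<dots>\<close> claims that edge \<open>r\<^sub>i\<close> leads from \<open>n\<^sub>i\<close> to \<open>n\<^sub>i\<^sub>+\<^sub>1\<close>; the last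
  edge letter only marks the end and its claim is not checked.
\<close>

fun zeros :: "nat list \<Rightarrow> nat" where
  "zeros [] = 0"
| "zeros (0 # w) = Suc (zeros w)"
| "zeros (Suc r # w) = 0"

lemma word_induct [case_names Nil digit edge]:
  assumes "P []" "\<And>w. P w \<Longrightarrow> P (0 # w)" "\<And>r w. P w \<Longrightarrow> P (Suc r # w)"
  shows "P w"
proof (induction w)
  case (Cons a w)
  then show ?case using assms by (cases a) auto
qed (rule assms(1))

fun after_edge :: "nat list \<Rightarrow> nat list option" where
  "after_edge [] = None"
| "after_edge (0 # w) = after_edge w"
| "after_edge (Suc r # w) = Some w"

definition mismatch :: "affine \<Rightarrow> nat list \<Rightarrow> rat" where
  "mismatch l w = (case after_edge w of None \<Rightarrow> 0 | Some w' \<Rightarrow>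
     ((1/2) ^ (src_mul l * zeros w + src_add l) - (1/2) ^ (tgt_mul l * zeros w' + tgt_add l))\<^sup>2)"

text \<open>
  For an edge with numbers \<open>x = 2\<^bsup>-(a n + s)\<^esup>\<close> and \<open>y = 2\<^bsup>-(b n' + t)\<^esup>\<close>, the threads \<open>SrcSq\<close>, \<open>TgtSq\<close>
  and \<open>Cross\<close> accept with probabilities \<open>1 - x\<^sup>2\<close>, \<open>1 - y\<^sup>2\<close> and \<open>x y\<close>; with weights 1, 1 and 2 this gives
  \<open>2 - (x - y)\<^sup>2\<close>. \<open>Main\<close> starts these threads at every edge letter, \<open>Damp\<close> compensates the part
  of the sum that depends on the number of edges, \<open>StartSq\<close> and \<open>StartCross\<close> compare the first
  number with the initial weight in the same way, and \<open>Ctrl\<close> follows the control states.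
\<close>

datatype 'q check_state =
    Sink | Damp | Main
  | SrcSq nat nat | TgtSq nat nat | TgtSqRun nat
  | Cross nat nat nat | CrossRun nat
  | StartSq | StartCross
  | Ctrl 'q | CtrlEnd

text \<open>If the word ends before the next edge letter, \<open>SrcSq\<close> and
  \<open>TgtSq\<close> count as 1 and \<open>Cross\<close> as 0. The weighted sum is then 2, the
  value of a perfect match, so the last claim costs nothing.\<close>

fun is_final :: "'q check_state \<Rightarrow> bool" where
  "is_final Sink \<longleftrightarrow> True"
| "is_final Damp \<longleftrightarrow> True"
| "is_final (SrcSq a s) \<longleftrightarrow> True"
| "is_final (TgtSq b t) \<longleftrightarrow> True"
| "is_final (CrossRun b) \<longleftrightarrow> True"
| "is_final CtrlEnd \<longleftrightarrow> True"
| "is_final _ \<longleftrightarrow> False"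

locale edge_system =
  fixes es :: "'q edge list" and q0 qf :: 'q
begin

definition max_coeff :: nat where
  "max_coeff = (\<Sum>e\<leftarrow>es. src_mul (label e) + src_add (label e) + tgt_mul (label e) + tgt_add (label e))"

text \<open>Small enough for the reward of \<open>Ctrl\<close> to be outweighed by a single mismatch.\<close>

definition decay :: rat where
  "decay = (1/4) ^ max_coeff / 32"

text \<open>The square threads send the lost mass to \<open>Sink\<close> and so accept with the
  complementary probability; the \<open>Cross\<close> threads drop it and so accept with the
  product. \<open>Cross\<close> multiplies in the source block digit by digit, both additive
  constants at the edge letter, and the target block after it.\<close>

fun trans :: "'q check_state \<Rightarrow> nat \<Rightarrow> ('q check_state \<times> rat) list" where
  "trans Sink _ = [(Sink, 1)]"
| "trans Damp 0 = [(Damp, 1)]"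
| "trans Damp (Suc r) = [(Damp, 1/2)]"
| "trans Main 0 = [(Main, 1)]"
| "trans Main (Suc r) = (let l = label (es ! r) in
     [(Main, 1/2), (SrcSq (src_mul l) (src_add l), 1/8), (TgtSq (tgt_mul l) (tgt_add l), 1/8),
      (Cross (src_mul l) (src_add l + tgt_add l) (tgt_mul l), 1/4)])"
| "trans (SrcSq a s) 0 = [(SrcSq a s, (1/4) ^ a), (Sink, 1 - (1/4) ^ a)]"
| "trans (SrcSq a s) (Suc r) = [(Sink, 1 - (1/4) ^ s)]"
| "trans (TgtSq b t) 0 = [(TgtSq b t, 1)]"
| "trans (TgtSq b t) (Suc r) = [(TgtSqRun b, (1/4) ^ t), (Sink, 1 - (1/4) ^ t)]"
| "trans (TgtSqRun b) 0 = [(TgtSqRun b, (1/4) ^ b), (Sink, 1 - (1/4) ^ b)]"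
| "trans (TgtSqRun b) (Suc r) = []"
| "trans (Cross a c b) 0 = [(Cross a c b, (1/2) ^ a)]"
| "trans (Cross a c b) (Suc r) = [(CrossRun b, (1/2) ^ c)]"
| "trans (CrossRun b) 0 = [(CrossRun b, (1/2) ^ b)]"
| "trans (CrossRun b) (Suc r) = [(Sink, 1)]"
| "trans StartSq 0 = []"
| "trans StartSq (Suc r) = [(TgtSqRun 1, 1)]"
| "trans StartCross 0 = []"
| "trans StartCross (Suc r) = [(CrossRun 1, 1)]"
| "trans (Ctrl q) 0 = [(Ctrl q, decay)]"
| "trans (Ctrl q) (Suc r) =
     (if q = qf then [(CtrlEnd, decay)]
      else if source (es ! r) = q then [(Ctrl (target (es ! r)), decay)] else [])"
| "trans CtrlEnd 0 = [(CtrlEnd, decay)]"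
| "trans CtrlEnd (Suc r) = []"

fun V :: "nat list \<Rightarrow> 'q check_state \<Rightarrow> rat" where
  "V [] s = (if is_final s then 1 else 0)"
| "V (a # w) s = (\<Sum>(t, x)\<leftarrow>trans s a. x * V w t)"

text \<open>\<open>R\<close> counts runs with multiplicity, including those of weight 0, so it is only an upper bound.\<close>

fun R :: "nat list \<Rightarrow> 'q check_state \<Rightarrow> nat" where
  "R [] s = (if is_final s then 1 else 0)"
| "R (a # w) s = (\<Sum>(t, x)\<leftarrow>trans s a. R w t)"

section \<open>Acceptance values of the threads\<close>

lemma quarter_power: "(1/4 :: rat) ^ n = ((1/2) ^ n)\<^sup>2"
  by (simp add: power2_eq_square power_mult_distrib[symmetric])

lemma V_Sink: "V w Sink = 1"
  by (induction w) auto

lemma V_SrcSq: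
  "V w (SrcSq a s) =
    (case after_edge w of None \<Rightarrow> 1 | Some w' \<Rightarrow> 1 - (1/4) ^ (a * zeros w + s))"
  by (induction w rule: word_induct)
    (auto simp: V_Sink algebra_simps power_add split: option.splits)

lemma V_TgtSqRun: "V w (TgtSqRun b) = 1 - (1/4) ^ (b * zeros w)"
  by (induction w rule: word_induct) (auto simp: V_Sink right_diff_distrib power_add)

lemma V_TgtSq:
  "V w (TgtSq b t) =
    (case after_edge w of None \<Rightarrow> 1 | Some w' \<Rightarrow> 1 - (1/4) ^ (b * zeros w' + t))"
  by (induction w rule: word_induct)
    (auto simp: V_Sink V_TgtSqRun algebra_simps power_add split: option.splits)

lemma V_CrossRun: "V w (CrossRun b) = (1/2) ^ (b * zeros w)"
  by (induction w rule: word_induct) (auto simp: V_Sink algebra_simps power_add)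

lemma V_Cross:
  "V w (Cross a c b) =
    (case after_edge w of None \<Rightarrow> 0 | Some w' \<Rightarrow> (1/2) ^ (a * zeros w + c + b * zeros w'))"
  by (induction w rule: word_induct)
    (auto simp: V_CrossRun algebra_simps power_add split: option.splits)

lemma V_gadget:
  "V w (SrcSq (src_mul l) (src_add l)) / 8 + V w (TgtSq (tgt_mul l) (tgt_add l)) / 8 +
   V w (Cross (src_mul l) (src_add l + tgt_add l) (tgt_mul l)) / 4 = 1/4 - mismatch l w / 8"
proof (cases "after_edge w")
  case (Some w')
  define x y :: rat where "x = (1/2) ^ (src_mul l * zeros w + src_add l)"
    and "y = (1/2) ^ (tgt_mul l * zeros w' + tgt_add l)"
  have "(1/2) ^ (src_mul l * zeros w + (src_add l + tgt_add l) + tgt_mul l * zeros w') = x * y"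
    by (simp add: x_def y_def power_add)
  moreover have "(1 - x\<^sup>2) / 8 + (1 - y\<^sup>2) / 8 + x * y / 4 = 1/4 - (x - y)\<^sup>2 / 8"
    by (simp add: power2_diff field_simps)
  ultimately show ?thesis
    using Some by (simp add: V_SrcSq V_TgtSq V_Cross mismatch_def quarter_power x_def y_def)
qed (simp add: V_SrcSq V_TgtSq V_Cross mismatch_def)

fun error :: "nat list \<Rightarrow> rat" where
  "error [] = 0"
| "error (0 # w) = error w"
| "error (Suc r # w) = error w / 2 + mismatch (label (es ! r)) w / 8"

lemma V_Damp_Suc: "V (Suc r # w) Damp = V w Damp / 2"
  by simp

text \<open>Without errors each edge letter maps the value \<open>m\<close> to
  \<open>m / 2 + 1/4\<close>. The fixed point is 1/2 and the start is 0, so after k edge letters the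
  deficit is half of 2^(-k), the value of \<open>Damp\<close>.\<close>

lemma V_Main: "V w Main = 1/2 - V w Damp / 2 - error w"
proof (induction w rule: word_induct)
  case (edge r w)
  let ?l = "label (es ! r)"
  have "V (Suc r # w) Main = V w Main / 2 + (V w (SrcSq (src_mul ?l) (src_add ?l)) / 8 +
      V w (TgtSq (tgt_mul ?l) (tgt_add ?l)) / 8 +
      V w (Cross (src_mul ?l) (src_add ?l + tgt_add ?l) (tgt_mul ?l)) / 4)"
    by (simp add: Let_def)
  then show ?case
    unfolding V_gadget using edge by (simp del: V.simps(2) add: V_Damp_Suc diff_divide_distrib)
qed auto

lemma V_Start:
  "V [] StartSq = 0" "V (0 # w) StartSq = 0" "V (Suc r # w) StartSq = 1 - ((1/2) ^ zeros w)\<^sup>2"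
  "V [] StartCross = 0" "V (0 # w) StartCross = 0" "V (Suc r # w) StartCross = (1/2) ^ zeros w"
  by (simp_all add: V_TgtSqRun V_CrossRun quarter_power)

text \<open>At \<open>qf\<close> the edge letter is compared with no source and no other edge letter
  may follow: it is the end marker. Digits are skipped, so this is control flow only.\<close>

fun path_ok :: "'q \<Rightarrow> nat list \<Rightarrow> bool" where
  "path_ok q [] \<longleftrightarrow> False"
| "path_ok q (0 # w) \<longleftrightarrow> path_ok q w"
| "path_ok q (Suc r # w) \<longleftrightarrow>
     (if q = qf then after_edge w = None else source (es ! r) = q \<and> path_ok (target (es ! r)) w)"

lemma V_CtrlEnd: "V w CtrlEnd = (if after_edge w = None then decay ^ length w else 0)"
  by (induction w rule: word_induct) auto

lemma V_Ctrl: "V w (Ctrl q) = (if path_ok q w then decay ^ length w else 0)"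
  by (induction q w rule: path_ok.induct) (auto simp: V_CtrlEnd)

lemma decay_bounds: "0 < decay" "decay \<le> 1/32"
  by (auto simp: decay_def power_le_one)

text \<open>\<open>Damp\<close> with 1/8 cancels the deficit of \<open>Main\<close> with 1/4.
  \<open>StartSq\<close>, \<open>StartCross\<close> and the term \<open>- \<rho>\<^sup>2 / 8\<close>
  of \<open>Sink\<close> complete the square (x - \<rho>)^2 / 8. The constants 1/8 from
  \<open>Main\<close>, 1/8 from \<open>StartSq\<close> and 1/4 from \<open>Sink\<close> add up to
  the threshold 1/2.\<close>

definition start_weight :: "rat \<Rightarrow> 'q check_state \<Rightarrow> rat" where
  "start_weight \<rho> s = (case s of Main \<Rightarrow> 1/4 | Damp \<Rightarrow> 1/8 | StartSq \<Rightarrow> 1/8 |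
     StartCross \<Rightarrow> \<rho> / 4 | Sink \<Rightarrow> 1/4 - \<rho>\<^sup>2 / 8 | Ctrl q \<Rightarrow> if q = q0 then 1/16 else 0 | _ \<Rightarrow> 0)"

definition start_value :: "rat \<Rightarrow> nat list \<Rightarrow> rat" where
  "start_value \<rho> w = V w Main / 4 + V w Damp / 8 + V w StartSq / 8 + \<rho> / 4 * V w StartCross +
     (1/4 - \<rho>\<^sup>2 / 8) * V w Sink + V w (Ctrl q0) / 16"

lemma start_value_Suc:
  "start_value \<rho> (Suc r # w) =
     1/2 - error (Suc r # w) / 4 - ((1/2) ^ zeros w - \<rho>)\<^sup>2 / 8 + V (Suc r # w) (Ctrl q0) / 16"
proof -
  define x where "x = (1/2 :: rat) ^ zeros w"
  define m where "m = V (Suc r # w) Main"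
  define h where "h = V (Suc r # w) Damp"
  have "m = 1/2 - h / 2 - error (Suc r # w)" unfolding m_def h_def by (rule V_Main)
  moreover have "(1 - x\<^sup>2) / 8 + \<rho> / 4 * x + (1/4 - \<rho>\<^sup>2 / 8) = 3/8 - (x - \<rho>)\<^sup>2 / 8"
    by (simp add: power2_diff field_simps)
  ultimately show ?thesis
    unfolding start_value_def V_Start V_Sink m_def[symmetric] x_def[symmetric] h_def[symmetric]
    by (simp add: field_simps)
qed

lemma mismatch_nonneg: "0 \<le> mismatch l w"
  by (simp add: mismatch_def split: option.splits)

lemma error_nonneg: "0 \<le> error w"
  by (induction w rule: word_induct) (auto simp: mismatch_nonneg intro!: add_nonneg_nonneg)

lemma V_Ctrl_le_1: "V w (Ctrl q) \<le> 1"
  using decay_bounds by (auto simp: V_Ctrl intro!: power_le_one)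

text \<open>A word that does not begin with an edge letter loses the 1/8 of \<open>StartSq\<close>,
  more than the reward of at most 1/16.\<close>

lemma start_value_not_Suc:
  assumes "w = [] \<or> (\<exists>w'. w = 0 # w')"
  shows "start_value \<rho> w \<le> 1/2"
proof -
  have "V w StartSq = 0" "V w StartCross = 0" using assms V_Start by auto
  then have "start_value \<rho> w = 3/8 - \<rho>\<^sup>2 / 8 - error w / 4 + V w (Ctrl q0) / 16"
    by (simp add: start_value_def V_Sink V_Main field_simps)
  moreover have "0 \<le> \<rho>\<^sup>2" by simp
  ultimately show ?thesis
    using V_Ctrl_le_1[of w q0] error_nonneg[of w] by linarith
qed

text \<open>Distinct powers of 1/2 differ by at least half of the larger one. The bound depends on
  \<open>p\<close> alone, so a bound on the source side suffices later.\<close>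

lemma half_power_diff_sq:
  fixes p p' :: nat
  assumes "p \<noteq> p'"
  shows "(1/4) ^ p / 4 \<le> ((1/2) ^ p - (1/2 :: rat) ^ p')\<^sup>2"
proof -
  have "(1/2) ^ p / 2 \<le> \<bar>(1/2) ^ p - (1/2 :: rat) ^ p'\<bar>"
  proof (cases "p < p'")
    case True
    then have "(1/2 :: rat) ^ p' \<le> (1/2) ^ Suc p" by (intro power_decreasing) auto
    then have "(1/2) ^ p / 2 \<le> (1/2 :: rat) ^ p - (1/2) ^ p'" by simp
    then show ?thesis by linarith
  next
    case False
    with assms have "(1/2 :: rat) ^ p \<le> (1/2) ^ Suc p'" by (intro power_decreasing) auto
    then have "(1/2 :: rat) ^ p * 2 \<le> (1/2) ^ p'" by simp
    moreover have "0 < (1/2 :: rat) ^ p" by simp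
    ultimately have "(1/2) ^ p / 2 \<le> (1/2 :: rat) ^ p' - (1/2) ^ p" by linarith
    then show ?thesis by linarith
  qed
  then have "((1/2) ^ p / 2)\<^sup>2 \<le> ((1/2) ^ p - (1/2 :: rat) ^ p')\<^sup>2"
    by (metis abs_ge_zero power2_abs power_mono divide_nonneg_pos zero_le_power
        zero_less_numeral zero_le_divide_1_iff zero_le_numeral)
  moreover have "((1/2 :: rat) ^ p / 2)\<^sup>2 = (1/4) ^ p / 4"
    unfolding quarter_power by (simp add: power2_eq_square)
  ultimately show ?thesis by simp
qed

lemma zeros_le_length: "zeros w \<le> length w"
  by (induction w rule: word_induct) auto

lemma max_coeff_ge:
  assumes "r < length es"
  shows "src_mul (label (es ! r)) \<le> max_coeff" "src_add (label (es ! r)) \<le> max_coeff"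
proof -
  have "es ! r \<in> set es" using assms by simp
  then have "src_mul (label (es ! r)) + src_add (label (es ! r)) + tgt_mul (label (es ! r)) +
      tgt_add (label (es ! r)) \<le> max_coeff"
    unfolding max_coeff_def by (intro member_le_sum_list) auto
  then show "src_mul (label (es ! r)) \<le> max_coeff" "src_add (label (es ! r)) \<le> max_coeff"
    by auto
qed

text \<open>An error in the tail is halved at an edge letter, and \<open>decay\<close> shrinks by
  more than that. If the tail is free of errors, the mismatch at this letter is at least (1/4)^p / 4
  with p at most \<open>max_coeff * Suc (length w)\<close>, and it has weight 1/8; the factors 4 and
  8 give the 32 in \<open>decay\<close>.\<close>

lemma error_lower_bound:
  "set w \<subseteq> {..length es} \<Longrightarrow> error w \<noteq> 0 \<Longrightarrow> decay ^ length w \<le> error w"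
proof (induction w rule: word_induct)
  case (digit w)
  have "decay ^ Suc (length w) \<le> decay ^ length w"
    using decay_bounds by (intro power_decreasing) auto
  with digit show ?case by auto
next
  case (edge r w)
  define l where "l = label (es ! r)"
  have r: "r < length es" using edge by auto
  show ?case
  proof (cases "error w = 0")
    case False
    have "decay * decay ^ length w \<le> 1/2 * decay ^ length w"
      using decay_bounds by (intro mult_right_mono) auto
    moreover have "decay ^ length w \<le> error w" using edge False by auto
    ultimately show ?thesis using mismatch_nonneg[of l w] by (simp add: l_def)
  next
    case True
    then have "mismatch l w \<noteq> 0" using edge by (simp add: l_def)
    then obtain w' where w': "after_edge w = Some w'"
      by (auto simp: mismatch_def split: option.splits)
    define p where "p = src_mul l * zeros w + src_add l"
    have "p \<noteq> tgt_mul l * zeros w' + tgt_add l"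
      using \<open>mismatch l w \<noteq> 0\<close> w' by (auto simp: mismatch_def p_def)
    then have *: "(1/4) ^ p / 4 \<le> mismatch l w"
      using half_power_diff_sq w' by (simp add: mismatch_def p_def)
    have "src_mul l * zeros w \<le> max_coeff * length w"
      using max_coeff_ge[OF r] zeros_le_length by (intro mult_le_mono) (auto simp: l_def)
    then have "p \<le> max_coeff * Suc (length w)"
      using max_coeff_ge[OF r] by (simp add: p_def l_def)
    then have "(1/4 :: rat) ^ (max_coeff * Suc (length w)) \<le> (1/4) ^ p"
      by (intro power_decreasing) auto
    moreover have "decay ^ Suc (length w) \<le> (1/4 :: rat) ^ (max_coeff * Suc (length w)) / 32"
    proof -
      have "(1/32 :: rat) ^ Suc (length w) \<le> (1/32) ^ 1" by (intro power_decreasing) auto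
      then have "((1/4) ^ max_coeff) ^ Suc (length w) * (1/32 :: rat) ^ Suc (length w) \<le>
          ((1/4) ^ max_coeff) ^ Suc (length w) * (1/32)"
        by (intro mult_left_mono) auto
      then show ?thesis
        unfolding decay_def power_mult
        by (simp only: divide_inverse power_mult_distrib power_inverse mult_1_left)
    qed
    ultimately have "decay ^ Suc (length w) \<le> mismatch l w / 8" using * by linarith
    then show ?thesis using True by (simp add: l_def)
  qed
qed auto

lemma error_zero_accepts:
  assumes "path_ok q (Suc r # w)" "set w \<subseteq> {..length es}" "r < length es"
    "error (Suc r # w) = 0"
  shows "accepts (set es) qf q (zeros w)"
  using assms
proof (induction "length w" arbitrary: q r w rule: less_induct)
  case less
  show ?case
  proof (cases "q = qf")
    case True
    then show ?thesis using accepts.stop by simp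
  next
    case False
    then have src: "source (es ! r) = q" and ok: "path_ok (target (es ! r)) w"
      using less.prems(1) by auto
    \<comment> \<open>Skips the digits up to the next edge letter, which exists because
      \<open>path_ok\<close> fails on words that end before reaching \<open>qf\<close>. The
      induction continues at that letter.\<close>
    have "\<exists>r' w'. after_edge w = Some w' \<and> path_ok (target (es ! r)) (Suc r' # w') \<and>
        error w = error (Suc r' # w') \<and> length w' < length w \<and> r' < length es \<and>
        set w' \<subseteq> {..length es}"
      using ok less.prems(2)
    proof (induction w rule: word_induct)
      case (digit w)
      then show ?case by (force simp: less_Suc_eq)
    qed auto
    then obtain r' w' where w': "after_edge w = Some w'"
        "path_ok (target (es ! r)) (Suc r' # w')" "error w = error (Suc r' # w')"
        "length w' < length w" "r' < length es" "set w' \<subseteq> {..length es}" by blast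
    have e0: "error w = 0" "mismatch (label (es ! r)) w = 0"
      using less.prems(4) error_nonneg[of w] mismatch_nonneg[of "label (es ! r)" w]
      by (auto simp: add_nonneg_eq_0_iff)
    then have "accepts (set es) qf (target (es ! r)) (zeros w')"
      using less.hyps w' by simp
    moreover have "(zeros w, zeros w') \<in> affine_rel (label (es ! r))"
    proof -
      define p p' where "p = src_mul (label (es ! r)) * zeros w + src_add (label (es ! r))"
        and "p' = tgt_mul (label (es ! r)) * zeros w' + tgt_add (label (es ! r))"
      have "((1/2) ^ p - (1/2 :: rat) ^ p')\<^sup>2 = 0"
        using e0(2) w'(1) by (simp add: mismatch_def p_def p'_def)
      moreover have "(0 :: rat) < (1/4) ^ p / 4" by simp
      ultimately have "p = p'" using half_power_diff_sq[of p p'] by linarith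
      then show ?thesis by (simp add: affine_rel_def p_def p'_def)
    qed
    ultimately show ?thesis
      using accepts.step[of "es ! r" "set es"] less.prems(3) src by auto
  qed
qed

lemma zeros_replicate: "zeros (replicate n 0 @ Suc r # w) = n"
  by (induction n) auto

lemma after_edge_replicate: "after_edge (replicate n 0 @ Suc r # w) = Some w"
  by (induction n) auto

lemma path_ok_replicate: "path_ok q (replicate n 0 @ w) = path_ok q w"
  by (induction n) auto

lemma error_replicate: "error (replicate n 0 @ w) = error w"
  by (induction n) auto

lemma accepts_error_zero:
  assumes "accepts (set es) qf q n" "es \<noteq> []"
  shows "\<exists>r w. r < length es \<and> set w \<subseteq> {..length es} \<and> path_ok q (Suc r # w) \<and>
    error (Suc r # w) = 0 \<and> zeros w = n"
  using assms
proof (induction rule: accepts.induct)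
  case (stop n)
  \<comment> \<open>Witness: edge 0 as end marker, followed by \<open>n\<close> digits. No edge
    letter follows, hence no mismatch arises.\<close>
  have "after_edge (replicate n 0) = None" "zeros (replicate n 0) = n" "error (replicate n 0) = 0"
    by (induction n) auto
  then show ?case
    using stop by (intro exI[of _ 0] exI[of _ "replicate n 0"]) (auto simp: mismatch_def)
next
  case (step e n n')
  then obtain r' w' where w': "r' < length es" "set w' \<subseteq> {..length es}"
      "path_ok (target e) (Suc r' # w')" "error (Suc r' # w') = 0" "zeros w' = n'" by auto
  obtain r where r: "r < length es" "es ! r = e" using step.hyps(1) by (auto simp: in_set_conv_nth)
  show ?case
  proof (cases "source e = qf")
    case True
    \<comment> \<open>The given path may pass through \<open>qf\<close>, whereas
      \<open>path_ok\<close> ends there. Since \<open>qf\<close> accepts every number, the word is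
      cut at this point.\<close>
    have "after_edge (replicate n 0) = None" "zeros (replicate n 0) = n" "error (replicate n 0) = 0"
      by (induction n) auto
    then show ?thesis
      using r True by (intro exI[of _ r] exI[of _ "replicate n 0"]) (auto simp: mismatch_def)
  next
    case False
    have "mismatch (label e) (replicate n 0 @ Suc r' # w') = 0"
      using step.hyps(2) w'(5)
      by (simp add: mismatch_def affine_rel_def zeros_replicate after_edge_replicate)
    then show ?thesis
      using r False w'
      by (intro exI[of _ r] exI[of _ "replicate n 0 @ Suc r' # w'"])
        (auto simp: zeros_replicate path_ok_replicate error_replicate simp del: error.simps(3),
         auto simp: error_replicate)
  qed
qed

text \<open>Without an accepting computation, a correct control path starts at a wrong number or
  contains a mismatch. Either quantity is at least the value of \<open>Ctrl\<close>, and its weight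
  1/8 or 1/4 exceeds the weight 1/16 of the reward.\<close>

theorem start_value_le_half_iff:
  assumes "es \<noteq> []"
  shows "(\<forall>w\<in>lists {..length es}. start_value ((1/2) ^ n) w \<le> 1/2) \<longleftrightarrow>
    \<not> accepts (set es) qf q0 n"
proof
  assume le: "\<forall>w\<in>lists {..length es}. start_value ((1/2) ^ n) w \<le> 1/2"
  show "\<not> accepts (set es) qf q0 n"
  proof
    assume "accepts (set es) qf q0 n"
    from accepts_error_zero[OF this assms] obtain r w where w: "r < length es"
      "set w \<subseteq> {..length es}" "path_ok q0 (Suc r # w)" "error (Suc r # w) = 0" "zeros w = n"
      by blast
    then have "start_value ((1/2) ^ n) (Suc r # w) = 1/2 + decay ^ length (Suc r # w) / 16"
      unfolding start_value_Suc by (simp add: V_Ctrl del: V.simps error.simps path_ok.simps)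
    moreover have "0 < decay ^ length (Suc r # w)" using decay_bounds by simp
    moreover have "Suc r # w \<in> lists {..length es}" using w by auto
    ultimately show False using le[rule_format, of "Suc r # w"] by linarith
  qed
next
  assume not_acc: "\<not> accepts (set es) qf q0 n"
  show "\<forall>w\<in>lists {..length es}. start_value ((1/2) ^ n) w \<le> 1/2"
  proof
    fix w assume w: "w \<in> lists {..length es}"
    show "start_value ((1/2) ^ n) w \<le> 1/2"
    proof (cases w rule: zeros.cases)
      case (3 r w')
      have w': "r < length es" "set w' \<subseteq> {..length es}" using w 3 by auto
      let ?d = "((1/2) ^ zeros w' - (1/2 :: rat) ^ n)\<^sup>2"
      have nonneg: "0 \<le> ?d" "0 \<le> error w" by (auto simp: error_nonneg)
      have "V w (Ctrl q0) \<le> ?d \<or> V w (Ctrl q0) \<le> error w"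
      proof (cases "path_ok q0 w")
        case True
        then have V: "V w (Ctrl q0) = decay ^ length w" by (simp add: V_Ctrl)
        show ?thesis
        proof (cases "zeros w' = n")
          case True
          then have "error w \<noteq> 0"
            using error_zero_accepts[of q0 r w'] \<open>path_ok q0 w\<close> w' not_acc 3 by auto
          then show ?thesis using error_lower_bound[of w] w V by auto
        next
          case False
          have "decay ^ length w \<le> (1/4) ^ length w"
            using decay_bounds by (intro power_mono) auto
          also have "\<dots> \<le> (1/4) ^ Suc (zeros w')"
            using zeros_le_length[of w'] 3 by (intro power_decreasing) auto
          also have "\<dots> \<le> ?d" using half_power_diff_sq[OF False] by simp
          finally show ?thesis using V by simp
        qed
      qed (use nonneg in \<open>simp add: V_Ctrl\<close>)
      moreover have "start_value ((1/2) ^ n) w = 1/2 - error w / 4 - ?d / 8 + V w (Ctrl q0) / 16"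
        using 3 start_value_Suc by simp
      ultimately show ?thesis using nonneg by linarith
    qed (use start_value_not_Suc in auto)
  qed
qed

section \<open>Linear bounds on the number of runs\<close>

fun next_zeros :: "nat list \<Rightarrow> nat" where
  "next_zeros w = (case after_edge w of None \<Rightarrow> 0 | Some w' \<Rightarrow> zeros w')"

lemma R_Sink: "R w Sink = 1"
  by (induction w) auto

lemma R_Damp: "R w Damp = 1"
  by (induction w rule: word_induct) auto

lemma R_SrcSq: "R w (SrcSq a s) \<le> Suc (zeros w)"
  by (induction w rule: word_induct) (auto simp: R_Sink)

lemma R_TgtSqRun: "R w (TgtSqRun b) \<le> zeros w"
  by (induction w rule: word_induct) (auto simp: R_Sink)

lemma R_TgtSq: "R w (TgtSq b t) \<le> Suc (next_zeros w)"
proof (induction w rule: word_induct)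
  case (edge r w)
  then show ?case using R_TgtSqRun[of w b] by (simp add: R_Sink)
qed auto

lemma R_CrossRun: "R w (CrossRun b) \<le> 1"
  by (induction w rule: word_induct) (auto simp: R_Sink)

lemma R_Cross: "R w (Cross a c b) \<le> 1"
  by (induction w rule: word_induct) (use R_CrossRun in auto)

text \<open>
  The threads started at an edge letter branch into \<open>Sink\<close> only during the next two blocks. The
  potential \<open>2 * zeros w + next_zeros w\<close> pays for this, which makes the bound linear.
\<close>

lemma R_Main: "R w Main + 2 * zeros w + next_zeros w \<le> 5 * length w"
proof (induction w rule: word_induct)
  case (edge r w)
  let ?l = "label (es ! r)"
  \<comment> \<open>The new threads cost at most \<open>zeros w + next_zeros w + 3\<close>. The old
    potential is \<open>2 * zeros w + next_zeros w\<close> and the new one is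
    \<open>zeros w\<close>, so the total grows by at most 3.\<close>
  show ?case
    using edge R_SrcSq[of w "src_mul ?l" "src_add ?l"] R_TgtSq[of w "tgt_mul ?l" "tgt_add ?l"]
      R_Cross[of w "src_mul ?l" "src_add ?l + tgt_add ?l" "tgt_mul ?l"]
    by (simp add: Let_def)
qed auto

lemma R_StartSq: "R w StartSq \<le> length w"
proof (induction w rule: word_induct)
  case (edge r w)
  then show ?case using R_TgtSqRun[of w 1] zeros_le_length[of w] by simp
qed auto

lemma R_StartCross: "R w StartCross \<le> 1"
  by (induction w rule: word_induct) (use R_CrossRun in auto)

lemma R_CtrlEnd: "R w CtrlEnd \<le> 1"
  by (induction w rule: word_induct) auto

lemma R_Ctrl: "R w (Ctrl q) \<le> 1"
proof (induction w arbitrary: q rule: word_induct)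
  case (edge r w)
  then show ?case using R_CtrlEnd[of w] by simp
qed auto

end

section \<open>The checking automaton\<close>

lemma pa_iso:
  assumes A: "is_pa A" and alph: "alphabet B = alphabet A"
    and g: "bij_betw g (states A) (states B)" and fin: "final B = g ` final A"
    and ini: "\<And>q. q \<in> states A \<Longrightarrow> init B (g q) = init A q"
    and del: "\<And>q a p. q \<in> states A \<Longrightarrow> a \<in> alphabet A \<Longrightarrow> p \<in> states A \<Longrightarrow>
      delta B (g q) a (g p) = delta A q a p"
  shows "is_pa B"
    and "\<And>w. w \<in> lists (alphabet A) \<Longrightarrow> acc_prob B w = acc_prob A w"
    and "\<And>w. w \<in> lists (alphabet A) \<Longrightarrow> card (accepting_runs B w) = card (accepting_runs A w)"
proof -
  have F: "final A \<subseteq> states A" using A by (simp add: is_pa_def)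
  have B_eq: "states B = g ` states A" using g by (simp add: bij_betw_def)
  have dist: "distribution_on (states B) e"
    if "distribution_on (states A) e'" "\<And>q. q \<in> states A \<Longrightarrow> e (g q) = e' q" for e e'
  proof -
    have "sum e (states B) = (\<Sum>q\<in>states A. e (g q))"
      by (rule sum.reindex_bij_betw[OF g, symmetric])
    also have "\<dots> = sum e' (states A)" using that by simp
    finally show ?thesis using that unfolding distribution_on_def B_eq by auto
  qed
  have "finite (states B)" using A by (simp add: is_pa_def B_eq)
  moreover have "distribution_on (states B) (delta B p a)" if "p \<in> states B" "a \<in> alphabet B" for p a
  proof -
    from that(1) B_eq obtain q where "q \<in> states A" "p = g q" by blast
    then show ?thesis
      using A that del alph by (intro dist[of "delta A q a"]) (auto simp: is_pa_def)
  qed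
  moreover have "distribution_on (states B) (init B)"
    using A ini by (intro dist[of "init A"]) (auto simp: is_pa_def)
  ultimately show B: "is_pa B"
    using A F fin alph by (auto simp: is_pa_def B_eq)
  fix w assume w: "w \<in> lists (alphabet A)"
  have "acc_prob B w = (\<Sum>q\<in>states A. init B (g q) * state_value B w (g q))"
    using w alph sum.reindex_bij_betw[OF g, of "\<lambda>p. init B p * state_value B w p"]
    by (simp add: acc_prob_eq_state_value[OF B])
  also have "\<dots> = acc_prob A w"
    using w ini state_value_iso[OF g fin F del w] by (simp add: acc_prob_eq_state_value[OF A])
  finally show "acc_prob B w = acc_prob A w" .
  have "{p \<in> states B. init B p > 0} = g ` {q \<in> states A. init A q > 0}"
    using ini by (auto simp: B_eq)
  then have "bij_betw g {q \<in> states A. init A q > 0} {p \<in> states B. init B p > 0}"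
    using g by (auto simp: bij_betw_def inj_on_def)
  from sum.reindex_bij_betw[OF this, of "state_runs B w"]
  show "card (accepting_runs B w) = card (accepting_runs A w)"
    unfolding card_accepting_runs[OF A] card_accepting_runs[OF B]
    using state_runs_iso[OF g fin F del w] by simp
qed

context edge_system
begin

definition control_states :: "'q set" where
  "control_states = insert q0 (insert qf (source ` set es \<union> target ` set es))"

definition check_states :: "'q check_state set" where
  "check_states =
     {Sink, Damp, Main, StartSq, StartCross, CtrlEnd, TgtSqRun 1, CrossRun 1} \<union>
     Ctrl ` control_states \<union>
     (\<Union>l\<in>label ` set es. {SrcSq (src_mul l) (src_add l), TgtSq (tgt_mul l) (tgt_add l),
        TgtSqRun (tgt_mul l), Cross (src_mul l) (src_add l + tgt_add l) (tgt_mul l),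
        CrossRun (tgt_mul l)})"

text \<open>Adding up the entries for one target makes sums over states agree with sums over the
  transition lists.\<close>

definition check_pa :: "('q check_state \<Rightarrow> rat) \<Rightarrow> (nat, 'q check_state) pa" where
  "check_pa \<iota> = \<lparr>alphabet = {..<Suc (length es)}, states = check_states,
     delta = (\<lambda>s a t. \<Sum>(t', x)\<leftarrow>trans s a. if t' = t then x else 0), init = \<iota>,
     final = {s \<in> check_states. is_final s}\<rparr>"

lemma check_pa_simps [simp]:
  "alphabet (check_pa \<iota>) = {..<Suc (length es)}" "states (check_pa \<iota>) = check_states"
  "delta (check_pa \<iota>) = (\<lambda>s a t. \<Sum>(t', x)\<leftarrow>trans s a. if t' = t then x else 0)"
  "init (check_pa \<iota>) = \<iota>" "final (check_pa \<iota>) = {s \<in> check_states. is_final s}"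
  by (simp_all add: check_pa_def)

lemma finite_check_states: "finite check_states"
  by (simp add: check_states_def control_states_def)

lemma trans_closed:
  assumes "s \<in> check_states" "a < Suc (length es)" "(t, x) \<in> set (trans s a)"
  shows "t \<in> check_states"
proof (cases a)
  case 0
  then show ?thesis
    using assms by (cases s) (auto simp: check_states_def)
next
  case (Suc r)
  then have "es ! r \<in> set es" using assms(2) by simp
  then show ?thesis
    using assms Suc
    by (cases s) (auto simp: check_states_def control_states_def Let_def split: if_splits)
qed

lemma trans_nonneg: "(t, x) \<in> set (trans s a) \<Longrightarrow> 0 \<le> x"
  using decay_bounds
  by (cases "(s, a)" rule: trans.cases)
    (auto simp: Let_def power_le_one less_imp_le split: if_splits)

lemma trans_total: "(\<Sum>(t, x)\<leftarrow>trans s a. x) \<le> 1"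
  using decay_bounds
  by (cases "(s, a)" rule: trans.cases) (auto simp: Let_def power_le_one)

lemma sum_check_delta:
  fixes f :: "'q check_state \<Rightarrow> rat"
  assumes "\<And>t x. (t, x) \<in> set xs \<Longrightarrow> t \<in> check_states"
  shows "(\<Sum>t\<in>check_states. (\<Sum>(t', x)\<leftarrow>xs. if t' = t then x else 0) * f t) =
    (\<Sum>(t, x)\<leftarrow>xs. x * f t)"
  using assms
proof (induction xs)
  case (Cons y xs)
  obtain t' x where y: "y = (t', x)" by (cases y)
  have "(\<Sum>t\<in>check_states. (if t' = t then x else 0) * f t) = x * f t'"
  proof -
    have "t' \<in> check_states" using Cons.prems y by auto
    then show ?thesis
      using finite_check_states by (simp add: if_distrib[of "\<lambda>z. z * _"] cong: if_cong)
  qed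
  moreover have "(\<Sum>t\<in>check_states. (\<Sum>(t', x)\<leftarrow>xs. if t' = t then x else 0) * f t) =
      (\<Sum>(t, x)\<leftarrow>xs. x * f t)"
    by (rule Cons.IH) (use Cons.prems in auto)
  ultimately show ?case using y by (simp add: distrib_right sum.distrib)
qed simp

lemma is_pa_check_pa:
  assumes "distribution_on check_states \<iota>"
  shows "is_pa (check_pa \<iota>)"
proof -
  have "distribution_on check_states (delta (check_pa \<iota>) s a)"
    if "s \<in> check_states" "a < Suc (length es)" for s a
  proof -
    have "(\<Sum>t\<in>check_states. \<Sum>(t', x)\<leftarrow>trans s a. if t' = t then x else 0) \<le> 1"
      using sum_check_delta[of "trans s a" "\<lambda>_. 1"] trans_closed[OF that] trans_total[of s a]
      by simp
    moreover have "0 \<le> (\<Sum>(t', x)\<leftarrow>trans s a. if t' = t then x else 0)" for t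
      using trans_nonneg by (intro sum_list_nonneg) auto
    ultimately show ?thesis by (simp add: distribution_on_def)
  qed
  then show ?thesis
    using assms finite_check_states by (auto simp: is_pa_def)
qed

lemma state_value_check_pa:
  "w \<in> lists {..<Suc (length es)} \<Longrightarrow> s \<in> check_states \<Longrightarrow>
    state_value (check_pa \<iota>) w s = V w s"
proof (induction w arbitrary: s)
  case (Cons a w)
  have a: "a < Suc (length es)" and w: "w \<in> lists {..<Suc (length es)}" using Cons.prems by auto
  have "state_value (check_pa \<iota>) (a # w) s =
      (\<Sum>(t, x)\<leftarrow>trans s a. x * state_value (check_pa \<iota>) w t)"
    using sum_check_delta[of "trans s a"] trans_closed[OF Cons.prems(2) a] by simp
  also have "\<dots> = V (a # w) s"
    using Cons.IH[OF w] trans_closed[OF Cons.prems(2) a]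
    by (auto intro!: arg_cong[of _ _ sum_list])
  finally show ?case .
qed simp

lemma state_runs_check_pa:
  "w \<in> lists {..<Suc (length es)} \<Longrightarrow> s \<in> check_states \<Longrightarrow>
    state_runs (check_pa \<iota>) w s \<le> R w s"
proof (induction w arbitrary: s)
  case (Cons a w)
  have a: "a < Suc (length es)" and w: "w \<in> lists {..<Suc (length es)}" using Cons.prems by auto
  \<comment> \<open>A positive sum forces an entry with target \<open>t\<close>, so every state
    counted on the left occurs in the list.\<close>
  have bound: "(\<Sum>t\<in>{t \<in> check_states. (\<Sum>(t', x)\<leftarrow>xs. if t' = t then x else 0) > (0::rat)}.
      f t) \<le> (\<Sum>(t, x)\<leftarrow>xs. f t)" for xs :: "('q check_state \<times> rat) list" and f :: "'q check_state \<Rightarrow> nat"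
  proof -
    have "t \<in> fst ` set xs" if "(\<Sum>(t', x)\<leftarrow>xs. if t' = t then x else 0) > (0::rat)" for t
      using that by (induction xs) (auto split: if_splits)
    then have "(\<Sum>t\<in>{t \<in> check_states. (\<Sum>(t', x)\<leftarrow>xs. if t' = t then x else 0) > (0::rat)}.
        f t) \<le> (\<Sum>t\<in>fst ` set xs. f t)"
      by (intro sum_mono2) auto
    also have "\<dots> \<le> (\<Sum>(t, x)\<leftarrow>xs. f t)"
    proof (induction xs)
      case (Cons y xs)
      then show ?case by (cases "fst y \<in> fst ` set xs") (auto simp: insert_absorb split: prod.splits)
    qed simp
    finally show ?thesis .
  qed
  have "state_runs (check_pa \<iota>) (a # w) s \<le>
      (\<Sum>(t, x)\<leftarrow>trans s a. state_runs (check_pa \<iota>) w t)"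
    using bound[where xs = "trans s a"] by simp
  also have "\<dots> \<le> R (a # w) s"
    using Cons.IH[OF w] trans_closed[OF Cons.prems(2) a]
    by (auto intro!: sum_list_mono)
  finally show ?case .
qed simp

definition start_states :: "'q check_state set" where
  "start_states = {Sink, Main, Damp, StartSq, StartCross, Ctrl q0}"

lemma start_states_subset: "start_states \<subseteq> check_states"
  by (auto simp: start_states_def check_states_def control_states_def)

lemma sum_start_states:
  "sum f start_states = f Sink + f Main + f Damp + f StartSq + f StartCross + f (Ctrl q0)"
  by (simp add: start_states_def add.assoc)

lemma sum_check_states_start:
  assumes "\<And>s. s \<notin> start_states \<Longrightarrow> f s = 0"
  shows "sum f check_states = sum f start_states"
  using assms start_states_subset finite_check_states
  by (intro sum.mono_neutral_right) auto

lemma linearly_ambiguous_check_pa: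
  assumes "distribution_on check_states \<iota>" and \<iota>: "\<And>s. s \<notin> start_states \<Longrightarrow> \<iota> s = 0"
    and "w \<in> lists {..<Suc (length es)}"
  shows "card (accepting_runs (check_pa \<iota>) w) \<le> 6 * length w + 4"
proof -
  have "card (accepting_runs (check_pa \<iota>) w) =
      (\<Sum>s\<in>{s \<in> check_states. \<iota> s > 0}. state_runs (check_pa \<iota>) w s)"
    using card_accepting_runs[OF is_pa_check_pa[OF assms(1)]] by simp
  also have "\<dots> \<le> (\<Sum>s\<in>start_states. state_runs (check_pa \<iota>) w s)"
  proof (rule sum_mono2)
    show "{s \<in> check_states. \<iota> s > 0} \<subseteq> start_states" using \<iota> by force
  qed (auto simp: start_states_def)
  also have "\<dots> \<le> (\<Sum>s\<in>start_states. R w s)"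
    using state_runs_check_pa[OF assms(3)] start_states_subset by (intro sum_mono) auto
  \<comment> \<open>Slope 5 comes from \<open>Main\<close> and 1 from \<open>StartSq\<close>;
    \<open>Sink\<close>, \<open>Damp\<close>, \<open>StartCross\<close> and \<open>Ctrl q0\<close>
    have at most one run each.\<close>
  also have "\<dots> \<le> 6 * length w + 4"
    using R_Main[of w] R_StartSq[of w] R_StartCross[of w] R_Ctrl[of w q0]
    by (simp add: sum_start_states R_Sink R_Damp)
  finally show ?thesis .
qed

lemma start_weight_zero: "s \<notin> start_states \<Longrightarrow> start_weight \<rho> s = 0"
  by (auto simp: start_weight_def start_states_def split: check_state.splits)

lemma distribution_start_weight:
  assumes "0 \<le> \<rho>" "\<rho> \<le> 1/2"
  shows "distribution_on check_states (start_weight \<rho>)"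
proof -
  have "\<rho>\<^sup>2 \<le> (1/2)\<^sup>2" using assms by (intro power_mono) auto
  then have sq: "\<rho>\<^sup>2 \<le> 1" by (simp add: power2_eq_square)
  then have "0 \<le> start_weight \<rho> s" for s
    using assms by (auto simp: start_weight_def split: check_state.splits)
  moreover have "sum (start_weight \<rho>) check_states \<le> 1"
  proof -
    have "sum (start_weight \<rho>) check_states = 13/16 + \<rho> / 4 - \<rho>\<^sup>2 / 8"
      using sum_check_states_start[of "start_weight \<rho>"]
      by (simp add: sum_start_states start_weight_zero start_weight_def[of \<rho> Sink]
          start_weight_def[of \<rho> Main] start_weight_def[of \<rho> Damp] start_weight_def[of \<rho> StartSq]
          start_weight_def[of \<rho> StartCross] start_weight_def[of \<rho> "Ctrl _"])
    moreover have "0 \<le> \<rho>\<^sup>2" by simp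
    ultimately show ?thesis using assms by linarith
  qed
  ultimately show ?thesis by (simp add: distribution_on_def)
qed

lemma acc_prob_check_pa:
  assumes "0 \<le> \<rho>" "\<rho> \<le> 1/2" "w \<in> lists {..<Suc (length es)}"
  shows "acc_prob (check_pa (start_weight \<rho>)) w = start_value \<rho> w"
proof -
  have "acc_prob (check_pa (start_weight \<rho>)) w =
      (\<Sum>s\<in>check_states. start_weight \<rho> s * V w s)"
    using acc_prob_eq_state_value[OF is_pa_check_pa[OF distribution_start_weight[OF assms(1,2)]]]
      assms(3) state_value_check_pa by simp
  also have "\<dots> = (\<Sum>s\<in>start_states. start_weight \<rho> s * V w s)"
    by (rule sum_check_states_start) (simp add: start_weight_zero)
  also have "\<dots> = start_value \<rho> w"
    by (simp add: sum_start_states start_weight_def start_value_def)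
  finally show ?thesis .
qed

text \<open>Since \<open>Sink\<close> always accepts, this start gives every word the value 1/2: the
  right-hand side of the containment problem.\<close>

definition half_weight :: "'q check_state \<Rightarrow> rat" where
  "half_weight s = (if s = Sink then 1/2 else 0)"

lemma half_weight_zero: "s \<notin> start_states \<Longrightarrow> half_weight s = 0"
  by (auto simp: half_weight_def start_states_def)

lemma distribution_half_weight: "distribution_on check_states half_weight"
proof -
  have "sum half_weight check_states = sum half_weight start_states"
    by (rule sum_check_states_start) (rule half_weight_zero)
  then show ?thesis unfolding sum_start_states by (simp add: distribution_on_def half_weight_def)
qed

lemma acc_prob_half:
  assumes "w \<in> lists {..<Suc (length es)}"
  shows "acc_prob (check_pa half_weight) w = 1/2"
proof -
  have "acc_prob (check_pa half_weight) w = (\<Sum>s\<in>check_states. half_weight s * V w s)"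
    using acc_prob_eq_state_value[OF is_pa_check_pa[OF distribution_half_weight]]
      assms state_value_check_pa by simp
  also have "\<dots> = (\<Sum>s\<in>start_states. half_weight s * V w s)"
    by (rule sum_check_states_start) (simp add: half_weight_zero)
  also have "\<dots> = 1/2"
    by (simp add: sum_start_states half_weight_def V_Sink)
  finally show ?thesis .
qed

end

section \<open>Undecidability\<close>

lemma rat_of_code_encode: "rat_of_code (prod_encode (m, d)) = of_nat m / of_nat (Suc d)"
  by (simp add: rat_of_code_def)

lemma lookup_code_encode:
  "lookup_code (list_encode (map prod_encode kvs)) x =
     (case map_of kvs x of None \<Rightarrow> 0 | Some v \<Rightarrow> rat_of_code v)"
  by (simp add: lookup_code_def comp_def)

text \<open>
  The diagonal argument lives on lists \<open>[k, n, d, f, \<dots>]\<close> that contain everything of the code of a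
  checking automaton except its initial table, followed by the numbers of the states that are
  initially active. The initial table is computed from the list itself: it makes the automaton check
  computations that start with this very list in the registers.
\<close>

definition start_number :: "nat list \<Rightarrow> nat" where
  "start_number xs = (\<Prod>r<10. nth_prime r ^ (xs ! r))"

definition frame_code :: "nat list \<Rightarrow> nat \<Rightarrow> nat" where
  "frame_code xs i = prod_encode (xs ! 0, prod_encode (xs ! 1, prod_encode (xs ! 2,
     prod_encode (i, xs ! 3))))"

text \<open>The pair \<open>(m, d)\<close> codes m / (d + 1), whence the subtractions of 1. With y =
  1 / \<rho> the weight of \<open>Sink\<close> is (2 y^2 - 1) / (8 y^2) and that of
  \<open>StartCross\<close> is 1 / (4 y). Entries 4 to 9 are the numbers of \<open>Sink\<close>,
  \<open>Main\<close>, \<open>Damp\<close>, \<open>StartSq\<close>, \<open>StartCross\<close> and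
  \<open>Ctrl q0\<close>.\<close>

definition check_code :: "nat list \<Rightarrow> nat" where
  "check_code xs = (let y = 2 ^ start_number xs in
     frame_code xs (list_encode (map prod_encode
       [(xs ! 4, prod_encode (2 * y * y - 1, 8 * y * y - 1)), (xs ! 5, prod_encode (1, 3)),
        (xs ! 6, prod_encode (1, 7)), (xs ! 7, prod_encode (1, 7)),
        (xs ! 8, prod_encode (1, 4 * y - 1)), (xs ! 9, prod_encode (1, 15))])))"

definition half_code :: "nat list \<Rightarrow> nat" where
  "half_code xs = frame_code xs (list_encode (map prod_encode [(xs ! 4, prod_encode (1, 1))]))"

lemma rec_fun_start_number: "rec_fun 10 start_number"
proof -
  have "rec_fun 10 (\<lambda>xs. \<Prod>r<n. nth_prime r ^ (xs ! r))" if "n \<le> 10" for n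
    using that by (induction n) (auto intro!: rec_fun_const rec_fun_mult rec_fun_power rec_fun_nth)
  then show ?thesis unfolding start_number_def by simp
qed

lemma rec_fun_check_code: "rec_fun 10 check_code"
  unfolding check_code_def frame_code_def Let_def list.map list_encode.simps
  by (intro rec_fun_intros rec_fun_start_number) simp_all

lemma rec_fun_half_code: "rec_fun 10 half_code"
  unfolding half_code_def frame_code_def list.map list_encode.simps
  by (intro rec_fun_intros) simp_all

text \<open>Collects the promises of both decision problems; the last clause turns containment in
  the second automaton into the bound 1/2.\<close>

definition good_frame :: "nat list \<Rightarrow> bool" where
  "good_frame xs \<longleftrightarrow> length xs = 10 \<and> linear_code (check_code xs) \<and> linear_code (half_code xs) \<and>
     alphabet (pa_of_code (check_code xs)) = alphabet (pa_of_code (half_code xs)) \<and>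
     (\<forall>w\<in>lists (alphabet (pa_of_code (half_code xs))). acc_prob (pa_of_code (half_code xs)) w = 1 / 2)"

lemma pa_of_frame_code:
  "pa_of_code (frame_code xs i) =
     \<lparr>alphabet = {..<xs ! 0}, states = {..<xs ! 1},
      delta = (\<lambda>q a p. lookup_code (xs ! 2) (prod_encode (q, prod_encode (a, p)))),
      init = lookup_code i, final = set (list_decode (xs ! 3))\<rparr>"
  by (simp add: frame_code_def pa_of_code_def)

lemma frame_code_exhaust:
  obtains k n d i f where "c = prod_encode (k, prod_encode (n, prod_encode (d, prod_encode (i, f))))"
  by (metis prod_decode_inverse surj_pair)

lemma linear_codeI:
  assumes "is_pa (pa_of_code c)"
    and "\<And>w. w \<in> lists (alphabet (pa_of_code c)) \<Longrightarrow>
      card (accepting_runs (pa_of_code c) w) \<le> m * length w + b"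
  shows "linear_code c"
proof -
  have "real (card (accepting_runs (pa_of_code c) w)) \<le> poly [:real b, real m:] (real (length w))"
    if "w \<in> lists (alphabet (pa_of_code c))" for w
  proof -
    have "real (card (accepting_runs (pa_of_code c) w)) \<le> real (m * length w + b)"
      using assms(2)[OF that] by (rule of_nat_mono)
    then show ?thesis by (simp add: mult.commute add.commute)
  qed
  moreover have "degree [:real b, real m:] \<le> 1" by simp
  ultimately show ?thesis
    using assms(1) unfolding linear_code_def linearly_ambiguous_def by blast
qed

text \<open>No circularity arises: transitions, final states and state numbers are fixed by coding
  the automaton with the initial distribution \<open>half_weight\<close>. They determine
  \<open>xs\<close>, hence the start number, hence the initial table that is substituted
  afterwards.\<close>

lemma (in edge_system) ex_good_frame:
  "\<exists>xs. good_frame xs \<and> alphabet (pa_of_code (check_code xs)) = {..length es} \<and>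
     (\<forall>w\<in>lists {..length es}.
        acc_prob (pa_of_code (check_code xs)) w = start_value ((1/2) ^ start_number xs) w)"
proof -
  have bij: "bij_betw id (alphabet (check_pa half_weight)) {..<Suc (length es)}" by simp
  obtain c g where raw: "is_pa (pa_of_code c)"
      "alphabet (pa_of_code c) = {..<Suc (length es)}"
      "bij_betw g (states (check_pa half_weight)) (states (pa_of_code c))"
      "final (pa_of_code c) = g ` final (check_pa half_weight)"
      "\<And>s. s \<in> states (check_pa half_weight) \<Longrightarrow>
         init (pa_of_code c) (g s) = init (check_pa half_weight) s"
      "\<And>s a t. s \<in> states (check_pa half_weight) \<Longrightarrow> a \<in> alphabet (check_pa half_weight) \<Longrightarrow>
         t \<in> states (check_pa half_weight) \<Longrightarrow>
         delta (pa_of_code c) (g s) (id a) (g t) = delta (check_pa half_weight) s a t"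
    by (rule pa_has_code[OF is_pa_check_pa[OF distribution_half_weight] bij]) (rule that)
  have c: "alphabet (pa_of_code c) = {..<Suc (length es)}"
      "bij_betw g check_states (states (pa_of_code c))"
      "final (pa_of_code c) = g ` {s \<in> check_states. is_final s}"
      "\<And>s a t. s \<in> check_states \<Longrightarrow> a < Suc (length es) \<Longrightarrow> t \<in> check_states \<Longrightarrow>
         delta (pa_of_code c) (g s) a (g t) = delta (check_pa half_weight) s a t"
    using raw by simp_all
  obtain k n d i f where knd: "c = prod_encode (k, prod_encode (n, prod_encode (d, prod_encode (i, f))))"
    by (rule frame_code_exhaust)
  define xs where
    "xs = [k, n, d, f, g Sink, g Main, g Damp, g StartSq, g StartCross, g (Ctrl q0)]"
  have "frame_code xs i = c" by (simp add: frame_code_def xs_def knd)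
  then have frame: "alphabet (pa_of_code (frame_code xs j)) = {..<Suc (length es)}"
      "bij_betw g check_states (states (pa_of_code (frame_code xs j)))"
      "final (pa_of_code (frame_code xs j)) = g ` {s \<in> check_states. is_final s}"
      "\<And>s a t. s \<in> check_states \<Longrightarrow> a < Suc (length es) \<Longrightarrow> t \<in> check_states \<Longrightarrow>
         delta (pa_of_code (frame_code xs j)) (g s) a (g t) = delta (check_pa \<iota>) s a t" for j \<iota>
    using c pa_of_frame_code[of xs i] by (simp_all add: pa_of_frame_code)
  have g_eq: "g s = g t \<longleftrightarrow> s = t" if "s \<in> check_states" "t \<in> check_states" for s t
    using c(2) that by (auto simp: bij_betw_def inj_on_def)
  have mem: "s \<in> check_states" if "s \<in> {Sink, Main, Damp, StartSq, StartCross, Ctrl q0}" for s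
    using start_states_subset that by (auto simp: start_states_def)
  have iso: "linear_code (frame_code xs j)"
      "\<And>w. w \<in> lists {..<Suc (length es)} \<Longrightarrow>
         acc_prob (pa_of_code (frame_code xs j)) w = acc_prob (check_pa \<iota>) w"
    if j: "\<And>s. s \<in> check_states \<Longrightarrow> lookup_code j (g s) = \<iota> s"
      and \<iota>: "distribution_on check_states \<iota>" "\<And>s. s \<notin> start_states \<Longrightarrow> \<iota> s = 0" for j \<iota>
  proof -
    have "init (pa_of_code (frame_code xs j)) = lookup_code j" by (simp add: pa_of_frame_code)
    note * = pa_iso[OF is_pa_check_pa[OF \<iota>(1)], of "pa_of_code (frame_code xs j)" g]
    have **: "is_pa (pa_of_code (frame_code xs j))"
      "\<And>w. w \<in> lists {..<Suc (length es)} \<Longrightarrow>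
         acc_prob (pa_of_code (frame_code xs j)) w = acc_prob (check_pa \<iota>) w"
      "\<And>w. w \<in> lists {..<Suc (length es)} \<Longrightarrow>
         card (accepting_runs (pa_of_code (frame_code xs j)) w) =
         card (accepting_runs (check_pa \<iota>) w)"
      using * frame j \<open>init _ = _\<close> by simp_all
    show "linear_code (frame_code xs j)"
      by (rule linear_codeI[of _ 6 4])
        (use ** linearly_ambiguous_check_pa[OF \<iota>] frame(1) in simp_all)
    show "\<And>w. w \<in> lists {..<Suc (length es)} \<Longrightarrow>
         acc_prob (pa_of_code (frame_code xs j)) w = acc_prob (check_pa \<iota>) w"
      by (rule **(2))
  qed
  define N where "N = start_number xs"
  define \<rho> :: rat where "\<rho> = (1/2) ^ N"
  have "N \<ge> 1"
    using prime_gt_0_nat[OF prime_nth_prime] by (simp add: N_def start_number_def Suc_le_eq)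
  then have \<rho>: "0 \<le> \<rho>" "\<rho> \<le> 1/2"
    using power_decreasing[of 1 N "1/2 :: rat"] by (simp_all add: \<rho>_def)
  define y where "y = (2::nat) ^ N"
  have y: "y > 0" "\<rho> = 1 / of_nat y" by (simp_all add: y_def \<rho>_def power_one_over)
  define j where "j = list_encode (map prod_encode
       [(xs ! 4, prod_encode (2 * y * y - 1, 8 * y * y - 1)), (xs ! 5, prod_encode (1, 3)),
        (xs ! 6, prod_encode (1, 7)), (xs ! 7, prod_encode (1, 7)),
        (xs ! 8, prod_encode (1, 4 * y - 1)), (xs ! 9, prod_encode (1, 15))])"
  have check: "check_code xs = frame_code xs j"
    by (simp add: check_code_def Let_def j_def y_def N_def)
  have sink: "rat_of_code (prod_encode (2 * y * y - 1, 8 * y * y - 1)) = 1/4 - \<rho>\<^sup>2 / 8"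
  proof -
    have "1 \<le> 2 * y * y" "1 \<le> 8 * y * y" using y(1) by (auto simp: Suc_le_eq)
    then show ?thesis
      unfolding y(2) using y(1)
      by (simp add: rat_of_code_encode of_nat_diff Suc_diff_le field_simps power2_eq_square)
  qed
  have cross: "rat_of_code (prod_encode (1, 4 * y - 1)) = \<rho> / 4"
    using y by (simp add: rat_of_code_encode)
  have unit_fractions: "rat_of_code (prod_encode (1, 3)) = 1/4"
      "rat_of_code (prod_encode (1, 7)) = 1/8" "rat_of_code (prod_encode (1, 15)) = 1/16"
    by (simp_all add: rat_of_code_encode)
  have look: "lookup_code j (g s) = start_weight \<rho> s" if "s \<in> check_states" for s
    unfolding j_def lookup_code_encode
    using that by (cases s)
      (simp_all add: xs_def g_eq mem start_weight_def sink cross unit_fractions del: One_nat_def)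
  have look_half: "lookup_code (list_encode (map prod_encode [(xs ! 4, prod_encode (1, 1))])) (g s) =
      half_weight s" if "s \<in> check_states" for s
    unfolding lookup_code_encode
    using that by (simp add: xs_def g_eq mem half_weight_def rat_of_code_encode)
  note check_iso = iso[OF look distribution_start_weight[OF \<rho>] start_weight_zero]
  note half_iso = iso[OF look_half distribution_half_weight half_weight_zero]
  have "good_frame xs"
    unfolding good_frame_def check half_code_def frame(1)
    using check_iso(1) half_iso acc_prob_half by (simp add: xs_def del: list.map)
  moreover have "acc_prob (pa_of_code (check_code xs)) w = start_value \<rho> w"
    if "w \<in> lists {..length es}" for w
    using that check_iso(2)[of w] acc_prob_check_pa[OF \<rho>] by (simp add: check lessThan_Suc_atMost)
  ultimately show ?thesis
    using frame(1)[of j]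
    by (intro exI[of _ xs]) (simp add: check lessThan_Suc_atMost \<rho>_def N_def)
qed

definition below_half :: "nat list \<Rightarrow> bool" where
  "below_half xs \<longleftrightarrow> (\<forall>w\<in>lists (alphabet (pa_of_code (check_code xs))).
     acc_prob (pa_of_code (check_code xs)) w \<le> 1 / 2)"

text \<open>The self-reference: the start number of the automaton for \<open>f\<close> encodes the
  frame of this same automaton, so the automaton searches for a halting computation of
  \<open>f\<close> on its own description.\<close>

lemma halting_frame:
  "\<exists>xs. good_frame xs \<and> (below_half xs \<longleftrightarrow> \<not> (\<exists>y. computes f xs y))"
proof -
  obtain P where P: "\<And>xs. length xs = 10 \<Longrightarrow>
      (\<exists>y. computes f xs y) \<longleftrightarrow> (\<exists>n'. (start_number xs, n') \<in> asem P)"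
    using computes_by_arith_prog[of 10 f] unfolding start_number_def by blast
  obtain es where es: "set es = prog_edges P" using finite_prog_edges finite_list by blast
  then have "es \<noteq> []" using prog_edges_nonempty[of P] by auto
  interpret edge_system es "[P]" "[]" .
  obtain xs where xs: "good_frame xs" "alphabet (pa_of_code (check_code xs)) = {..length es}"
      "\<forall>w\<in>lists {..length es}.
        acc_prob (pa_of_code (check_code xs)) w = start_value ((1/2) ^ start_number xs) w"
    using ex_good_frame by blast
  then have "below_half xs \<longleftrightarrow>
      (\<forall>w\<in>lists {..length es}. start_value ((1/2) ^ start_number xs) w \<le> 1/2)"
    by (simp add: below_half_def)
  also have "\<dots> \<longleftrightarrow> \<not> (\<exists>y. computes f xs y)"
    using start_value_le_half_iff[OF \<open>es \<noteq> []\<close>] P xs(1)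
    by (simp add: es accepts_prog_edges_iff good_frame_def)
  finally show ?thesis using xs(1) by blast
qed

lemma no_decider:
  "\<not> (\<forall>xs. good_frame xs \<longrightarrow> computes D xs (if below_half xs then 1 else 0))"
proof
  assume D: "\<forall>xs. good_frame xs \<longrightarrow> computes D xs (if below_half xs then 1 else 0)"
  obtain m where "\<forall>xs. length xs = 1 \<longrightarrow> computes m xs (1 - xs ! 0)"
    using rec_fun_one_minus[OF rec_fun_nth[of 0 1]] by (auto simp: rec_fun_def)
  then have m: "computes m [z] (1 - z)" for z by (metis length_Cons list.size(3) nth_Cons_0 One_nat_def)
  \<comment> \<open>The projections drop the search variable of \<open>Mu\<close>, so
    \<open>h\<close> is constant in it: the answer 1 becomes 0 and stops the search at once, the
    answer 0 becomes 1 and makes it run forever.\<close>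
  define h where "h = Comp m [Comp D (map Proj [1..<11])]"
  obtain xs where xs: "good_frame xs" "below_half xs \<longleftrightarrow> \<not> (\<exists>y. computes (Mu h) xs y)"
    using halting_frame by blast
  have len: "length xs = 10" using xs(1) by (simp add: good_frame_def)
  have h: "computes h (n # xs) (if below_half xs then 0 else 1)" for n
  proof -
    have "list_all2 (\<lambda>g z. computes g (n # xs) z) (map Proj [1..<11]) xs"
      using len by (auto simp: list_all2_conv_all_nth computes_Proj_iff)
    then have "computes (Comp D (map Proj [1..<11])) (n # xs) (if below_half xs then 1 else 0)"
      using D xs(1) unfolding computes_Comp_iff by blast
    then have "computes h (n # xs) (1 - (if below_half xs then 1 else 0))"
      unfolding h_def by (intro computes.comp[OF _ m]) simp
    then show ?thesis by (simp split: if_splits)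
  qed
  have "(\<exists>y. computes (Mu h) xs y) \<longleftrightarrow> below_half xs"
  proof
    assume "\<exists>y. computes (Mu h) xs y"
    then obtain y where "computes h (y # xs) 0" by (auto simp: computes_Mu_iff)
    from computes_deterministic[OF h[of y] this] show "below_half xs" by (simp split: if_splits)
  next
    assume "below_half xs"
    then have "computes (Mu h) xs 0" using h[of 0] by (simp add: computes_Mu_iff)
    then show "\<exists>y. computes (Mu h) xs y" ..
  qed
  with xs(2) show False by blast
qed

theorem theorem2:
  "\<not> decidable_on
       {[c] | c. linear_code c}
       {[c] | c. \<forall>w\<in>lists (alphabet (pa_of_code c)). acc_prob (pa_of_code c) w \<le> 1 / 2}
   \<and>
   \<not> decidable_on
       {[c, d] | c d. linear_code c \<and> linear_code d \<and>
                      alphabet (pa_of_code c) = alphabet (pa_of_code d)}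
       {[c, d] | c d. \<forall>w\<in>lists (alphabet (pa_of_code c)).
                        acc_prob (pa_of_code c) w \<le> acc_prob (pa_of_code d) w}"
proof -
  obtain fc where fc: "\<And>xs. length xs = 10 \<Longrightarrow> computes fc xs (check_code xs)"
    using rec_fun_check_code by (auto simp: rec_fun_def)
  obtain fh where fh: "\<And>xs. length xs = 10 \<Longrightarrow> computes fh xs (half_code xs)"
    using rec_fun_half_code by (auto simp: rec_fun_def)
  show ?thesis
  proof (intro conjI notI)
    assume "decidable_on {[c] | c. linear_code c}
       {[c] | c. \<forall>w\<in>lists (alphabet (pa_of_code c)). acc_prob (pa_of_code c) w \<le> 1 / 2}"
    then obtain D where D: "\<forall>xs\<in>{[c] | c. linear_code c}. computes D xs
        (if xs \<in> {[c] | c. \<forall>w\<in>lists (alphabet (pa_of_code c)).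
            acc_prob (pa_of_code c) w \<le> 1 / 2} then 1 else 0)" (is "\<forall>xs\<in>_. computes D xs (if xs \<in> ?Y then 1 else 0)")
      unfolding decidable_on_def by blast
    have "computes (Comp D [fc]) xs (if below_half xs then 1 else 0)" if "good_frame xs" for xs
    proof (rule computes.comp[of _ _ "[check_code xs]"])
      show "list_all2 (\<lambda>g z. computes g xs z) [fc] [check_code xs]"
        using that fc by (simp add: good_frame_def)
      have "below_half xs \<longleftrightarrow> [check_code xs] \<in> ?Y" unfolding below_half_def by blast
      moreover have "[check_code xs] \<in> {[c] | c. linear_code c}"
        using that unfolding good_frame_def by blast
      ultimately show "computes D [check_code xs] (if below_half xs then 1 else 0)"
        using bspec[OF D] by (simp only:)
    qed
    with no_decider show False by blast
  next
    assume "decidable_on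
       {[c, d] | c d. linear_code c \<and> linear_code d \<and>
                      alphabet (pa_of_code c) = alphabet (pa_of_code d)}
       {[c, d] | c d. \<forall>w\<in>lists (alphabet (pa_of_code c)).
                        acc_prob (pa_of_code c) w \<le> acc_prob (pa_of_code d) w}"
    then obtain D where D: "\<forall>xs\<in>{[c, d] | c d. linear_code c \<and> linear_code d \<and>
          alphabet (pa_of_code c) = alphabet (pa_of_code d)}. computes D xs
        (if xs \<in> {[c, d] | c d. \<forall>w\<in>lists (alphabet (pa_of_code c)).
            acc_prob (pa_of_code c) w \<le> acc_prob (pa_of_code d) w} then 1 else 0)"
      (is "\<forall>xs\<in>?I. computes D xs (if xs \<in> ?Y then 1 else 0)")
      unfolding decidable_on_def by blast
    have "computes (Comp D [fc, fh]) xs (if below_half xs then 1 else 0)" if "good_frame xs" for xs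
    proof (rule computes.comp[of _ _ "[check_code xs, half_code xs]"])
      show "list_all2 (\<lambda>g z. computes g xs z) [fc, fh] [check_code xs, half_code xs]"
        using that fc fh by (simp add: good_frame_def)
      \<comment> \<open>The automaton of \<open>half_code\<close> has value 1/2 on every word over
        the common alphabet.\<close>
      have "below_half xs \<longleftrightarrow> (\<forall>w\<in>lists (alphabet (pa_of_code (check_code xs))).
          acc_prob (pa_of_code (check_code xs)) w \<le> acc_prob (pa_of_code (half_code xs)) w)"
        using that unfolding good_frame_def below_half_def by metis
      then have "below_half xs \<longleftrightarrow> [check_code xs, half_code xs] \<in> ?Y" by blast
      moreover have "[check_code xs, half_code xs] \<in> ?I"
        using that unfolding good_frame_def by blast
      ultimately show "computes D [check_code xs, half_code xs] (if below_half xs then 1 else 0)"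
        using bspec[OF D] by (simp only:)
    qed
    with no_decider show False by blast
  qed
qed

end
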